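(* Let $F_1,\dots,F_h\in\mathbb{Z}[x_1,\dots,x_d]$ be nonzero polynomials and let $U_1,\dots,U_w$ be nonempty subsets of $\{F_1,\dots,F_h\}$ such that for all $1\le i\le w$, $$\gcd(F_1,F_2,\dots,F_h)=\gcd(F:F\in U_i)=1\quad\text{in } \mathbb{Q}[x_1,\dots,x_d].$$ Let $r\le w$ be a positive integer, let $y_1,\dots,y_r$ be positive integers, and let $y=\prod_{j=1}^{\infty}p_j^{s_j}$ be a positive integer ($s_j$ nonnegative integers) such that $y_i\mid y$ for all $1\le i\le r$. Put $$\mathcal{Z}=\{(z_1,\dots,z_w)\in\mathbb{Z}_+^w:\ z_i=y_i\ \text{for all } i\le r\}.$$ Then the density $\lambda(\mathcal{Z})$ exists, and $$\lambda(\mathcal{Z})=\prod_{j=1}^{\infty}\lambda_{p_j^{s_j+1}}(\mathcal{Z}).$$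
   Context: $p_j$ denotes the $j$-th smallest prime; $d,h,w$ are positive integers; $\mathbb{Z}_+$ is the set of positive integers. For a positive integer $k$, $\mathbb{Z}_{(k)}=\{-k,-k+1,\dots,k\}$. For $x\in\mathbb{Z}^d$ let $g_i(x)=\gcd(F(x):F\in U_i)\ge 0$ (with $g_i(x)=0$ if all the values are $0$) and $g(x)=(g_1(x),\dots,g_w(x))\in\mathbb{Z}^w$. For $\mathcal{Z}\subseteq\mathbb{Z}^w$, $\lambda^{(k)}(\mathcal{Z})$ is the probability that $g(x)\in\mathcal{Z}$ when $x$ is uniformly distributed over $\mathbb{Z}_{(k)}^d$, and $\lambda(\mathcal{Z})=\lim_{k\to\infty}\lambda^{(k)}(\mathcal{Z})$ if the limit exists. For a prime $p$ and a positive integer $s$, $\lambda_{p^s}(\mathcal{Z})$ is the probability, for $x$ uniformly distributed over $(\mathbb{Z}/p^s\mathbb{Z})^d$, that $g(x)\in\mathcal{Z}\ (\mathrm{mod}\ p^s)$ up to multiplication of the components of $g$ by units, i.e. that there is $z\in\mathcal{Z}$ such that for every $i$ the element $g_i(x)$ of $\mathbb{Z}/p^s\mathbb{Z}$ (well defined up to a unit, e.g. by computing it from any integer lift of $x$) equals $z_i$ mod $p^s$ up to multiplication by a unit of $\mathbb{Z}/p^s\mathbb{Z}$ (the unit may depend on $i$). The infinite product is the limit of its partial products (all factors lie in $[0,1]$). *)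

theory Defs
  imports "HOL-Probability.Probability" "HOL-Library.Poly_Mapping" "HOL-Library.Infinite_Set"
    "HOL-Number_Theory.Cong"
begin

text \<open>A multivariate polynomial maps exponent vectors, that is finitely supported maps
  from indices of variables to exponents, to coefficients; its ring operations are those of
  \<^theory>\<open>HOL-Library.Poly_Mapping\<close>. The variables of $R[x_1,\dots,x_d]$ have the
  indices $1,\dots,d$.\<close>

type_synonym 'a mpoly = "(nat \<Rightarrow>\<^sub>0 nat) \<Rightarrow>\<^sub>0 'a"

definition mpoly_ring :: "nat \<Rightarrow> 'a::zero mpoly set" where
  "mpoly_ring d = {P. \<forall>m\<in>Poly_Mapping.keys P. Poly_Mapping.keys m \<subseteq> {1..d}}"

definition mpoly_eval :: "'a::comm_semiring_1 mpoly \<Rightarrow> (nat \<Rightarrow> 'a) \<Rightarrow> 'a" where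
  "mpoly_eval P x =
     (\<Sum>m\<in>Poly_Mapping.keys P. Poly_Mapping.lookup P m *
        (\<Prod>i\<in>Poly_Mapping.keys m. x i ^ Poly_Mapping.lookup m i))"

definition rat_mpoly :: "int mpoly \<Rightarrow> rat mpoly" where
  "rat_mpoly P = Poly_Mapping.map of_int P"

definition mpoly_divides :: "nat \<Rightarrow> 'a::comm_semiring_1 mpoly \<Rightarrow> 'a mpoly \<Rightarrow> bool" where
  "mpoly_divides d D P \<longleftrightarrow> (\<exists>Q\<in>mpoly_ring d. P = D * Q)"

text \<open>Greatest common divisors in $R[x_1,\dots,x_d]$ are determined only up to units,
  so this is a relation.\<close>

definition is_mpoly_gcd :: "nat \<Rightarrow> 'a::comm_semiring_1 mpoly set \<Rightarrow> 'a mpoly \<Rightarrow> bool" where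
  "is_mpoly_gcd d A G \<longleftrightarrow>
     G \<in> mpoly_ring d \<and> (\<forall>P\<in>A. mpoly_divides d G P) \<and>
     (\<forall>D\<in>mpoly_ring d. (\<forall>P\<in>A. mpoly_divides d D P) \<longrightarrow> mpoly_divides d D G)"

text \<open>Vectors in $S^n$ are the extensional functions in \<^term>\<open>{1..n} \<rightarrow>\<^sub>E S\<close>.
  The family \<open>U\<close> of sets of polynomials is indexed by $1,\dots,w$.\<close>

definition gcd_vec :: "nat \<Rightarrow> (nat \<Rightarrow> int mpoly set) \<Rightarrow> (nat \<Rightarrow> int) \<Rightarrow> nat \<Rightarrow> int" where
  "gcd_vec w U x = (\<lambda>i\<in>{1..w}. Gcd ((\<lambda>P. mpoly_eval P x) ` U i))"

definition box_prob ::
  "nat \<Rightarrow> nat \<Rightarrow> (nat \<Rightarrow> int mpoly set) \<Rightarrow> nat \<Rightarrow> (nat \<Rightarrow> int) set \<Rightarrow> real" where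
  "box_prob d w U k Z =
     measure_pmf.prob (pmf_of_set ({1..d} \<rightarrow>\<^sub>E {- int k..int k})) {x. gcd_vec w U x \<in> Z}"

definition density_exists ::
  "nat \<Rightarrow> nat \<Rightarrow> (nat \<Rightarrow> int mpoly set) \<Rightarrow> (nat \<Rightarrow> int) set \<Rightarrow> bool" where
  "density_exists d w U Z \<longleftrightarrow> convergent (\<lambda>k. box_prob d w U k Z)"

definition gcd_density ::
  "nat \<Rightarrow> nat \<Rightarrow> (nat \<Rightarrow> int mpoly set) \<Rightarrow> (nat \<Rightarrow> int) set \<Rightarrow> real" where
  "gcd_density d w U Z = lim (\<lambda>k. box_prob d w U k Z)"

text \<open>The elements of $\mathbb{Z}/p^s\mathbb{Z}$ are represented by their lifts
  $0,\dots,p^s-1$. Replacing a lift by a congruent one changes the components of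
  \<^const>\<open>gcd_vec\<close> modulo $p^s$ only by units, to which the condition is insensitive.\<close>

definition local_prob ::
  "nat \<Rightarrow> nat \<Rightarrow> (nat \<Rightarrow> int mpoly set) \<Rightarrow> nat \<Rightarrow> nat \<Rightarrow> (nat \<Rightarrow> int) set \<Rightarrow> real" where
  "local_prob d w U p s Z =
     measure_pmf.prob (pmf_of_set ({1..d} \<rightarrow>\<^sub>E {0..<int (p ^ s)}))
       {x. \<exists>z\<in>Z. \<forall>i\<in>{1..w}. \<exists>u. coprime u (int (p ^ s)) \<and>
              [gcd_vec w U x i = u * z i] (mod int (p ^ s))}"

text \<open>The \<open>j\<close>-th smallest prime for \<open>j \<ge> 1\<close>; the enumeration itself starts at 0.\<close>

definition nth_prime :: "nat \<Rightarrow> nat" where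
  "nth_prime j = enumerate {p. prime p} (j - 1)"

end

theory Submission
  imports Defs "HOL-Computational_Algebra.Polynomial"
begin

text \<open>The proof is a sieve over the primes. Fix the \<open>j\<close>-th prime $p$ and put $q = p^{s_j+1}$. Since $q$ does not
divide $y_i$ for $i \le r$, the residue of $x$ modulo $q$ decides whether $g_i(x)$ has the same $p$-adic
valuation as $y_i$; the coordinates $i > r$ impose nothing locally, because every residue class contains
positive integers. Hence the local probability at $p$ is the density of a set that is periodic modulo $q$
(\<open>local_prob_eq_residue_density\<close>), and by the Chinese remainder theorem the set $A_n$ of points
satisfying the conditions at the first $n$ primes has the $n$-th partial product as its density
(\<open>residue_density_prod\<close>, \<open>box_density_periodic\<close>). Every $x$ with $g(x) \in \mathcal{Z}$ lies
in $A_n$. Conversely, if $s_j = 0$ for all $j > n$, $x \in A_n$ and $g(x) \notin \mathcal{Z}$, then for some $i$ a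
prime beyond the first \<open>n\<close> divides $g_i(x)$; this includes the case $g_i(x) = 0$. So the theorem follows once
such points are known to be rare.

That is the lemma \<open>large_prime_set_small\<close>, the tail estimate of Ekedahl and Poonen: if the polynomials
in $U$ have no common factor over $\mathbb{Q}$, then the upper density of the points at which some prime
$p > M$ divides all the values tends to $0$ as $M \to \infty$. The proof is by induction on the number of
variables. Write $x = (x', t)$ with $t$ the last coordinate and expand the polynomials in powers of $t$.

\<^item> All the coefficients together again have no common factor. So, by induction, for most $x'$ no prime
  $p > M$ divides all their values, and then $t$ is restricted to boundedly many classes modulo $p$.
\<^item> Elimination of $t$ gives a nonzero $R$ in the ideal of $U$ that does not involve $t$
  (\<open>elimination\<close>), and $p$ must divide $R(x')$.

In a box of side $K$ the primes $M < p \le K$ gain a factor of order $1/p$ from each of the two restrictions;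
they contribute a proportion of order $\sum_{p>M} p^{-2} \le 1/M$. For $p > K$ there are, for each $x'$ with
$R(x') \ne 0$, only boundedly many candidates $p$, since $R(x')$ is bounded by a power of $K$, and each of
them admits boundedly many $t$; this and the points with $R(x') = 0$ contribute $O(1/K)$.

Elimination rests on Gauss' lemma over $\mathbb{Q}[x_1,\dots,x_n]$. The number of variables varies in the
induction, so factoriality is developed for subrings of one fixed integral domain and is shown to pass from
$A$ to $A[t]$.\<close>

section \<open>Factorial subrings of an integral domain\<close>

definition subring_set :: "'a::idom set \<Rightarrow> bool" where
  "subring_set A \<longleftrightarrow> 1 \<in> A \<and> (\<forall>a\<in>A. \<forall>b\<in>A. a - b \<in> A \<and> a * b \<in> A)"

lemma subring_setD:
  assumes "subring_set A"
  shows "1 \<in> A" "0 \<in> A" "\<And>a b. a \<in> A \<Longrightarrow> b \<in> A \<Longrightarrow> a - b \<in> A"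
    "\<And>a b. a \<in> A \<Longrightarrow> b \<in> A \<Longrightarrow> a * b \<in> A"
    "\<And>a b. a \<in> A \<Longrightarrow> b \<in> A \<Longrightarrow> a + b \<in> A"
proof -
  show 1: "1 \<in> A" and d: "\<And>a b. a \<in> A \<Longrightarrow> b \<in> A \<Longrightarrow> a - b \<in> A"
    and "\<And>a b. a \<in> A \<Longrightarrow> b \<in> A \<Longrightarrow> a * b \<in> A"
    using assms by (auto simp: subring_set_def)
  show 0: "0 \<in> A" using d[OF 1 1] by simp
  show "a + b \<in> A" if "a \<in> A" "b \<in> A" for a b
    using d[OF that(1) d[OF 0 that(2)]] by simp
qed

lemma subring_set_sum:
  assumes "subring_set A" "\<And>i. i \<in> I \<Longrightarrow> f i \<in> A"
  shows "sum f I \<in> A"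
  using assms(2) by (induction I rule: infinite_finite_induct) (auto intro: subring_setD[OF assms(1)])

definition divides_in :: "'a::idom set \<Rightarrow> 'a \<Rightarrow> 'a \<Rightarrow> bool" where
  "divides_in A a b \<longleftrightarrow> (\<exists>c\<in>A. b = a * c)"

definition prime_in :: "'a::idom set \<Rightarrow> 'a \<Rightarrow> bool" where
  "prime_in A p \<longleftrightarrow> p \<in> A \<and> p \<noteq> 0 \<and> \<not> divides_in A p 1 \<and>
     (\<forall>a\<in>A. \<forall>b\<in>A. divides_in A p (a * b) \<longrightarrow> divides_in A p a \<or> divides_in A p b)"

text \<open>Kaplansky's form of factoriality: every nonzero element is a unit times a product of primes. Compared with
unique factorization into irreducibles it gives directly what the arguments below use, an induction
that splits off one prime factor at a time, and it needs no notion of size for the elements of \<open>A\<close>.\<close>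

inductive prime_product :: "'a::idom set \<Rightarrow> 'a \<Rightarrow> bool" for A where
  unit: "a \<in> A \<Longrightarrow> divides_in A a 1 \<Longrightarrow> prime_product A a"
| mult: "prime_in A p \<Longrightarrow> prime_product A a \<Longrightarrow> prime_product A (p * a)"

definition factorial_set :: "'a::idom set \<Rightarrow> bool" where
  "factorial_set A \<longleftrightarrow> subring_set A \<and> (\<forall>a\<in>A. a \<noteq> 0 \<longrightarrow> prime_product A a)"

definition polys_over :: "'a::idom set \<Rightarrow> 'a poly set" where
  "polys_over A = {f. \<forall>i. coeff f i \<in> A}"

lemma polys_overD: "f \<in> polys_over A \<Longrightarrow> coeff f i \<in> A"
  by (simp add: polys_over_def)

lemma subring_set_polys_over:
  assumes "subring_set A"
  shows "subring_set (polys_over A)"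
proof -
  have "coeff (f * g) i \<in> A" if "f \<in> polys_over A" "g \<in> polys_over A" for f g i
    unfolding coeff_mult using that polys_overD
    by (intro subring_set_sum[OF assms] subring_setD(4)[OF assms]) auto
  moreover have "coeff (1 :: 'a poly) i \<in> A" for i
    using subring_setD(1,2)[OF assms] by (cases i) auto
  ultimately show ?thesis
    unfolding subring_set_def[of "polys_over A"]
    using subring_setD(3)[OF assms] by (simp add: polys_over_def)
qed

lemma const_in_polys_over [simp]:
  assumes "subring_set A"
  shows "[:a:] \<in> polys_over A \<longleftrightarrow> a \<in> A"
  using subring_setD(2)[OF assms]
  by (auto simp: polys_over_def coeff_pCons split: nat.splits)

lemma smult_in_polys_over:
  assumes "subring_set A" "a \<in> A" "f \<in> polys_over A"
  shows "smult a f \<in> polys_over A"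
  using assms by (auto simp: polys_over_def intro: subring_setD)

lemma monom_in_polys_over:
  assumes "subring_set A" "a \<in> A"
  shows "monom a k \<in> polys_over A"
  using assms by (auto simp: polys_over_def intro: subring_setD)

lemma const_divides_in_polys_over:
  assumes "subring_set A" "a \<in> A" "f \<in> polys_over A"
  shows "divides_in (polys_over A) [:a:] f \<longleftrightarrow> (\<forall>i. divides_in A a (coeff f i))"
proof
  assume "divides_in (polys_over A) [:a:] f"
  then show "\<forall>i. divides_in A a (coeff f i)"
    by (auto simp: divides_in_def polys_over_def)
next
  assume "\<forall>i. divides_in A a (coeff f i)"
  then obtain q where q: "q i \<in> A" "coeff f i = a * q i" for i
    unfolding divides_in_def by metis
  define g where "g = (\<Sum>i\<le>degree f. monom (q i) i)"
  have "g \<in> polys_over A"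
    unfolding g_def using q assms(1)
    by (intro subring_set_sum subring_set_polys_over monom_in_polys_over) auto
  moreover have "f = [:a:] * g"
  proof (rule poly_eqI)
    fix i
    show "coeff f i = coeff ([:a:] * g) i"
      using q(2)[of i] coeff_eq_0[of f i] by (auto simp: g_def coeff_sum)
  qed
  ultimately show "divides_in (polys_over A) [:a:] f"
    by (auto simp: divides_in_def)
qed

lemma divides_in_sum:
  assumes "subring_set A" "\<And>i. i \<in> I \<Longrightarrow> divides_in A a (f i)"
  shows "divides_in A a (sum f I)"
proof -
  obtain c where "\<And>i. i \<in> I \<Longrightarrow> c i \<in> A \<and> f i = a * c i"
    using assms(2) unfolding divides_in_def by metis
  then have "sum f I = a * sum c I" "sum c I \<in> A"
    by (auto simp: sum_distrib_left intro: subring_set_sum[OF assms(1)])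
  then show ?thesis by (auto simp: divides_in_def)
qed

lemma divides_in_diff:
  assumes "subring_set A" "divides_in A a b" "divides_in A a c"
  shows "divides_in A a (b - c)"
  using assms unfolding divides_in_def
  by (metis right_diff_distrib' subring_setD(3))

lemma divides_in_mult:
  assumes "subring_set A" "divides_in A a b" "c \<in> A"
  shows "divides_in A a (b * c)" "divides_in A a (c * b)"
proof -
  obtain e where "e \<in> A" "b = a * e" using assms(2) by (auto simp: divides_in_def)
  then show "divides_in A a (b * c)"
    unfolding divides_in_def using subring_setD(4)[OF assms(1) \<open>e \<in> A\<close> assms(3)]
    by (intro bexI[of _ "e * c"]) (simp_all add: mult.assoc)
  then show "divides_in A a (c * b)" by (simp add: mult.commute)
qed

lemma divides_in_trans:
  assumes "subring_set A" "divides_in A a b" "divides_in A b c"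
  shows "divides_in A a c"
  using assms unfolding divides_in_def by (metis mult.assoc subring_setD(4))

text \<open>Gauss' lemma for one prime: if \<open>p\<close> divides neither \<open>f\<close> nor \<open>g\<close>, take the first coefficients
$f_i$ and $g_j$ that it does not divide. In the coefficient of degree $i + j$ of the product every summand
except $f_i g_j$ is divisible by \<open>p\<close>.\<close>

lemma prime_in_const_poly:
  assumes A: "subring_set A" and p: "prime_in A p"
  shows "prime_in (polys_over A) [:p:]"
proof -
  note d = const_divides_in_polys_over[OF A, of p]
  have pA: "p \<in> A" "p \<noteq> 0" "\<not> divides_in A p 1" using p by (auto simp: prime_in_def)
  have "\<not> divides_in (polys_over A) [:p:] 1"
    using d[OF pA(1)] pA(3) subring_setD(1)[OF subring_set_polys_over[OF A]]
    by (auto dest: spec[of _ 0])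
  moreover have "divides_in (polys_over A) [:p:] f \<or> divides_in (polys_over A) [:p:] g"
    if f: "f \<in> polys_over A" and g: "g \<in> polys_over A"
      and fg: "divides_in (polys_over A) [:p:] (f * g)" for f g
  proof (rule ccontr)
    assume "\<not> ?thesis"
    then have ex: "\<exists>i. \<not> divides_in A p (coeff f i)" "\<exists>i. \<not> divides_in A p (coeff g i)"
      using d[OF pA(1)] f g by auto
    define i where "i = (LEAST i. \<not> divides_in A p (coeff f i))"
    define j where "j = (LEAST j. \<not> divides_in A p (coeff g j))"
    have i: "\<not> divides_in A p (coeff f i)" "\<And>k. k < i \<Longrightarrow> divides_in A p (coeff f k)"
      and j: "\<not> divides_in A p (coeff g j)" "\<And>k. k < j \<Longrightarrow> divides_in A p (coeff g k)"
      unfolding i_def j_def using LeastI_ex[OF ex(1)] LeastI_ex[OF ex(2)] not_less_Least by blast+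
    have "divides_in A p (coeff (f * g) (i + j))"
      using d[OF pA(1)] fg subring_setD(4)[OF subring_set_polys_over[OF A] f g] by auto
    moreover have "divides_in A p (\<Sum>k\<in>{..i+j} - {i}. coeff f k * coeff g (i + j - k))"
    proof (rule divides_in_sum[OF A])
      fix k assume k: "k \<in> {..i+j} - {i}"
      show "divides_in A p (coeff f k * coeff g (i + j - k))"
      proof (cases "k < i")
        case True
        then show ?thesis using i(2) g by (intro divides_in_mult[OF A]) (auto dest: polys_overD)
      next
        case False
        then have "i + j - k < j" using k by auto
        then show ?thesis using j(2) f by (intro divides_in_mult[OF A]) (auto dest: polys_overD)
      qed
    qed
    moreover have "coeff (f * g) (i + j) =
        coeff f i * coeff g j + (\<Sum>k\<in>{..i+j} - {i}. coeff f k * coeff g (i + j - k))"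
      unfolding coeff_mult by (subst sum.remove[of _ i]) auto
    ultimately have "divides_in A p (coeff f i * coeff g j)"
      using divides_in_diff[OF A, of p "coeff (f * g) (i + j)"
          "\<Sum>k\<in>{..i+j} - {i}. coeff f k * coeff g (i + j - k)"] by simp
    then show False
      using p i(1) j(1) f g unfolding prime_in_def by (auto dest: polys_overD)
  qed
  ultimately show ?thesis
    using pA A by (auto simp: prime_in_def)
qed

inductive_set ideal_gen :: "'a::idom set \<Rightarrow> 'a set \<Rightarrow> 'a set" for B U where
  base: "f \<in> U \<Longrightarrow> f \<in> ideal_gen B U"
| diff: "f \<in> ideal_gen B U \<Longrightarrow> g \<in> ideal_gen B U \<Longrightarrow> f - g \<in> ideal_gen B U"
| mult: "b \<in> B \<Longrightarrow> f \<in> ideal_gen B U \<Longrightarrow> b * f \<in> ideal_gen B U"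

lemma ideal_gen_subset:
  assumes "subring_set B" "U \<subseteq> B" "f \<in> ideal_gen B U"
  shows "f \<in> B"
  using assms(3,2) by induction (auto intro: subring_setD[OF assms(1)])

lemma ideal_gen_pair:
  assumes B: "subring_set B" and "f \<in> ideal_gen B {a, b}"
  shows "\<exists>u\<in>B. \<exists>v\<in>B. f = u * a + v * b"
  using assms(2)
proof induction
  case (base f)
  then show ?case
    using subring_setD(1,2)[OF B] by (metis add_0 add_0_right insertE mult_1 mult_zero_left singletonD)
next
  case (diff f g)
  then obtain u v u' v' where "u \<in> B" "v \<in> B" "u' \<in> B" "v' \<in> B" 
    "f = u * a + v * b" "g = u' * a + v' * b" by blast
  then show ?case
    by (intro bexI[of _ "u - u'"] bexI[of _ "v - v'"]) (auto simp: algebra_simps intro: subring_setD[OF B])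
next
  case (mult c f)
  then obtain u v where "u \<in> B" "v \<in> B" "f = u * a + v * b" by blast
  then show ?case using mult
    by (intro bexI[of _ "c * u"] bexI[of _ "c * v"]) (auto simp: algebra_simps intro: subring_setD[OF B])
qed

text \<open>A nonzero element \<open>h\<close> of least degree in the ideal generated by \<open>U\<close> divides every element of the ideal up to
a constant factor, by pseudo-division: the remainder lies in the ideal and has smaller degree, so it vanishes. Over
the fraction field \<open>h\<close> would be the greatest common divisor.\<close>

lemma ideal_min_degree:
  fixes U :: "'a::idom poly set"
  assumes A: "subring_set A" and U: "U \<subseteq> polys_over A" and nz: "f0 \<in> U" "f0 \<noteq> 0"
  shows "\<exists>h\<in>ideal_gen (polys_over A) U. h \<noteq> 0 \<and>
           (\<forall>f\<in>U. \<exists>a\<in>A. a \<noteq> 0 \<and> (\<exists>q\<in>polys_over A. smult a f = q * h))"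
proof -
  note B = subring_set_polys_over[OF A]
  let ?I = "ideal_gen (polys_over A) U"
  have "f0 \<in> ?I \<and> f0 \<noteq> 0" using nz by (auto intro: ideal_gen.base)
  from exists_least_lemma[of "\<lambda>n. \<exists>h. h \<in> ?I \<and> h \<noteq> 0 \<and> degree h \<le> n"]
  obtain h where h: "h \<in> ?I" "h \<noteq> 0" and min: "\<And>f. f \<in> ?I \<Longrightarrow> f \<noteq> 0 \<Longrightarrow> degree h \<le> degree f"
    using \<open>f0 \<in> ?I \<and> f0 \<noteq> 0\<close>
    using ex_has_least_nat[of "\<lambda>h. h \<in> ?I \<and> h \<noteq> 0" f0 degree] by metis
  have hB: "h \<in> polys_over A" using ideal_gen_subset[OF B U h(1)] .
  have main: "\<exists>a\<in>A. a \<noteq> 0 \<and> (\<exists>q\<in>polys_over A. smult a f = q * h)" if "f \<in> ?I" for f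
    using that
  proof (induction "degree f" arbitrary: f rule: less_induct)
    case less
    show ?case
    proof (cases "f = 0")
      case True
      then show ?thesis
        using subring_setD[OF A] subring_setD[OF B] by (intro bexI[of _ 1]) auto
    next
      case False
      have fB: "f \<in> polys_over A" using ideal_gen_subset[OF B U less.prems] .
      have le: "degree h \<le> degree f" using min[OF less.prems False] .
      define l where "l = lead_coeff h"
      define m where "m = monom (lead_coeff f) (degree f - degree h)"
      have l: "l \<in> A" "l \<noteq> 0" using hB h by (auto simp: l_def dest: polys_overD)
      have m: "m \<in> polys_over A"
        unfolding m_def using fB A by (auto intro!: monom_in_polys_over dest: polys_overD)
      define f' where "f' = [:l:] * f - m * h"
      have f'I: "f' \<in> ?I" unfolding f'_def using l m h less.prems A
        by (intro ideal_gen.diff ideal_gen.mult) auto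
      show ?thesis
      proof (cases "f' = 0")
        case True
        then have "smult l f = m * h" by (simp add: f'_def)
        then show ?thesis using l m by blast
      next
        case False
        have "degree f' < degree f"
        proof -
          have d: "degree (smult l f) = degree f" "degree (m * h) = degree f"
            using l le \<open>f \<noteq> 0\<close> h by (auto simp: m_def degree_mult_eq degree_monom_eq monom_eq_0_iff)
          have "coeff f' (degree f) = 0"
          proof -
            have "coeff (m * h) (degree f) = lead_coeff (m * h)" using d by simp
            also have "\<dots> = lead_coeff f * l"
              by (simp add: lead_coeff_mult m_def degree_monom_eq \<open>f \<noteq> 0\<close> l_def)
            finally show ?thesis by (simp add: f'_def)
          qed
          moreover have "degree f' \<le> degree f"
            unfolding f'_def using d by (intro degree_diff_le) auto
          ultimately show ?thesis
            using False by (metis le_neq_implies_less leading_coeff_0_iff)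
        qed
        from less.hyps[OF this f'I] obtain a q where
          a: "a \<in> A" "a \<noteq> 0" "q \<in> polys_over A" "smult a f' = q * h" by blast
        have "smult (a * l) f = (q + smult a m) * h"
          using a(4) by (simp add: f'_def smult_diff_right algebra_simps)
        then show ?thesis
          using a l m by (intro bexI[of _ "a * l"] conjI bexI[of _ "q + smult a m"])
            (auto intro: subring_setD[OF A] subring_setD[OF B] smult_in_polys_over[OF A])
      qed
    qed
  qed
  then show ?thesis
    using h by (intro bexI[of _ h]) (auto intro: ideal_gen.base)
qed

lemma const_divides_smultE:
  assumes "divides_in (polys_over A) [:p:] f"
  obtains g where "g \<in> polys_over A" "f = smult p g"
  using assms by (auto simp: divides_in_def)

text \<open>Removal of the denominator \<open>c\<close>. For each prime factor \<open>p\<close> of \<open>c\<close>, Gauss' lemma says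
that \<open>p\<close> divides \<open>h\<close> or else all the cofactors, and in both cases it can be cancelled. Since only
constants are removed from \<open>h\<close>, its degree is preserved, which makes a common divisor over the fraction
field into one of the same degree over \<open>A\<close>.\<close>

lemma cancel_constant:
  assumes A: "subring_set A" and c: "prime_product A c"
    and "h \<in> polys_over A"
    and "\<forall>f\<in>U. f \<in> polys_over A \<and> (\<exists>q\<in>polys_over A. smult c f = q * h)"
  shows "\<exists>h'\<in>polys_over A. degree h' = degree h \<and> (\<forall>f\<in>U. divides_in (polys_over A) h' f)"
  using c assms(3-)
proof (induction arbitrary: h)
  case (unit c)
  then obtain e where e: "e \<in> A" "c * e = 1" by (auto simp: divides_in_def)
  have "divides_in (polys_over A) h f" if f: "f \<in> U" for f
  proof -
    obtain q where q: "q \<in> polys_over A" "smult c f = q * h" using unit f by blast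
    have "f = smult (c * e) f" using e by simp
    also have "\<dots> = smult e (smult c f)" by (simp add: mult.commute)
    also have "\<dots> = h * smult e q" using q by (simp add: mult.commute)
    finally show ?thesis unfolding divides_in_def using q e smult_in_polys_over[OF A] by blast
  qed
  then show ?case using unit by blast
next
  case (mult p c)
  note pp = prime_in_const_poly[OF A mult.hyps(1)]
  have p0: "p \<noteq> 0" using mult.hyps(1) by (auto simp: prime_in_def)
  show ?case
  proof (cases "divides_in (polys_over A) [:p:] h")
    case True
    then obtain h1 where h1: "h1 \<in> polys_over A" "h = smult p h1" by (rule const_divides_smultE)
    have "f \<in> polys_over A \<and> (\<exists>q\<in>polys_over A. smult c f = q * h1)" if f: "f \<in> U" for f
    proof -
      obtain q where q: "f \<in> polys_over A" "q \<in> polys_over A" "smult (p * c) f = q * h"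
        using mult f by blast
      then have "smult p (smult c f) = smult p (q * h1)" using h1 by simp
      then have "smult c f = q * h1" using p0 by (metis smult_cancel)
      then show ?thesis using q by blast
    qed
    then have "\<exists>h'\<in>polys_over A. degree h' = degree h1 \<and> (\<forall>f\<in>U. divides_in (polys_over A) h' f)"
      by (intro mult.IH h1) auto
    then show ?thesis using h1 p0 by simp
  next
    case False
    have "f \<in> polys_over A \<and> (\<exists>q\<in>polys_over A. smult c f = q * h)" if f: "f \<in> U" for f
    proof -
      obtain q where q: "f \<in> polys_over A" "q \<in> polys_over A" "smult (p * c) f = q * h"
        using mult f by blast
      have "c \<in> A" using mult.hyps(2) by induction (auto simp: prime_in_def intro: subring_setD[OF A])
      then have "divides_in (polys_over A) [:p:] (q * h)"
        unfolding q(3)[symmetric] divides_in_def using q smult_in_polys_over[OF A]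
        by (intro bexI[of _ "smult c f"]) (auto simp: mult.commute)
      then have "divides_in (polys_over A) [:p:] q"
        using pp False q mult.prems by (auto simp: prime_in_def)
      then obtain q1 where q1: "q1 \<in> polys_over A" "q = smult p q1" by (rule const_divides_smultE)
      have "smult p (smult c f) = smult p (q1 * h)" using q q1 by simp
      then have "smult c f = q1 * h" using p0 by (metis smult_cancel)
      then show ?thesis using q q1 by blast
    qed
    then show ?thesis by (intro mult.IH mult.prems) auto
  qed
qed

lemma prime_product_in:
  assumes "subring_set A" "prime_product A a"
  shows "a \<in> A"
  using assms(2) by induction (auto simp: prime_in_def intro: subring_setD[OF assms(1)])

lemma prime_product_nonunit:
  assumes "prime_product A a" "subring_set A" "\<not> divides_in A a 1"
  shows "\<exists>p. prime_in A p \<and> divides_in A p a"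
  using assms prime_product_in[OF assms(2)] by cases (auto simp: divides_in_def)

lemma prime_product_mult:
  assumes "subring_set A" "prime_product A a" "prime_product A b"
  shows "prime_product A (a * b)"
  using assms(2)
proof induction
  case (unit a)
  then obtain e where e: "e \<in> A" "a * e = 1" by (auto simp: divides_in_def)
  from assms(3) show ?case
  proof induction
    case (unit b)
    then obtain e' where "e' \<in> A" "b * e' = 1" by (auto simp: divides_in_def)
    then have "a * b * (e * e') = 1" "e * e' \<in> A" using e
      by (metis mult.assoc mult.commute mult.right_neutral) (use e \<open>e' \<in> A\<close> subring_setD(4)[OF assms(1)] in auto)
    then show ?case using unit \<open>a \<in> A\<close> subring_setD(4)[OF assms(1)]
      by (intro prime_product.unit) (auto simp: divides_in_def intro!: bexI[of _ "e * e'"])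
  next
    case (mult p b)
    then show ?case by (metis mult.left_commute prime_product.mult)
  qed
next
  case (mult p a)
  then show ?case by (metis mult.assoc prime_product.mult)
qed

definition primitive_over :: "'a::idom set \<Rightarrow> 'a poly \<Rightarrow> bool" where
  "primitive_over A f \<longleftrightarrow> f \<in> polys_over A \<and> (\<forall>p. prime_in A p \<longrightarrow> \<not> divides_in (polys_over A) [:p:] f)"

text \<open>The same cancellation when the divisor \<open>f\<close> has no prime constant factor; then all the primes go
into the cofactor, and \<open>f\<close> itself is the divisor that is obtained.\<close>

lemma cancel_constant_primitive:
  assumes A: "subring_set A" and c: "prime_product A c"
    and f: "primitive_over A f"
    and "g \<in> polys_over A" "e \<in> polys_over A" "smult c g = f * e"
  shows "divides_in (polys_over A) f g"
  using c assms(4-)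
proof (induction arbitrary: e)
  case (unit c)
  then obtain c' where c': "c' \<in> A" "c * c' = 1" by (auto simp: divides_in_def)
  have "g = smult (c * c') g" using c' by simp
  also have "\<dots> = smult c' (smult c g)" by (simp add: mult.commute)
  also have "\<dots> = f * smult c' e" using unit by simp
  finally show ?case unfolding divides_in_def using unit c' smult_in_polys_over[OF A] by blast
next
  case (mult p c)
  note pp = prime_in_const_poly[OF A mult.hyps(1)]
  have p0: "p \<noteq> 0" using mult.hyps(1) by (auto simp: prime_in_def)
  have "divides_in (polys_over A) [:p:] (f * e)"
    unfolding mult.prems(3)[symmetric] divides_in_def
    using mult smult_in_polys_over[OF A] prime_product_in[OF A]
    by (intro bexI[of _ "smult c g"]) (auto simp: mult.commute)
  then have "divides_in (polys_over A) [:p:] e"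
    using pp f mult unfolding primitive_over_def prime_in_def by blast
  then obtain e1 where e1: "e1 \<in> polys_over A" "e = smult p e1" by (rule const_divides_smultE)
  have "smult p (smult c g) = smult p (f * e1)" using mult e1 by simp
  then have "smult c g = f * e1" using p0 by (metis smult_cancel)
  then show ?case using mult e1 by blast
qed

text \<open>The prime factors of the leading coefficient bound what can be split off from \<open>f\<close>. The induction runs
over a product \<open>l\<close> of primes with the property that every constant divisor of \<open>f\<close> divides \<open>l\<close>: a
prime \<open>p\<close> of \<open>l\<close> is either divided out of \<open>f\<close>, or dropped from \<open>l\<close> because no constant
divisor of \<open>f\<close> is divisible by it.\<close>

lemma primitive_part:
  assumes A: "factorial_set A" and f: "f \<in> polys_over A" "f \<noteq> 0"
  shows "\<exists>c\<in>A. \<exists>g. primitive_over A g \<and> f = smult c g"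
proof -
  have R: "subring_set A" using A by (simp add: factorial_set_def)
  note B = subring_set_polys_over[OF R]
  have gen: "\<exists>c\<in>A. \<exists>g. primitive_over A g \<and> f = smult c g"
    if "prime_product A l" "f \<in> polys_over A" 
      "\<And>c. c \<in> A \<Longrightarrow> divides_in (polys_over A) [:c:] f \<Longrightarrow> divides_in A c l" for l f
    using that
  proof (induction arbitrary: f)
    case (unit l)
    have "primitive_over A f" unfolding primitive_over_def
    proof (intro conjI allI impI notI)
      fix p assume p: "prime_in A p" "divides_in (polys_over A) [:p:] f"
      then have "divides_in A p l" using unit by (auto simp: prime_in_def)
      then have "divides_in A p 1" using unit divides_in_trans[OF R] by blast
      then show False using p by (auto simp: prime_in_def)
    qed (use unit in auto)
    then show ?case using subring_setD(1)[OF R] by (intro bexI[of _ 1] exI[of _ f]) auto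
  next
    case (mult p l)
    have p: "p \<in> A" "p \<noteq> 0" using mult by (auto simp: prime_in_def)
    have lA: "l \<in> A" using mult.hyps prime_product_in[OF R] by blast
    show ?case
    proof (cases "divides_in (polys_over A) [:p:] f")
      case True
      then obtain f1 where f1: "f1 \<in> polys_over A" "f = smult p f1" by (rule const_divides_smultE)
      have "\<exists>c\<in>A. \<exists>g. primitive_over A g \<and> f1 = smult c g"
      proof (rule mult.IH[OF f1(1)])
        fix c assume c: "c \<in> A" "divides_in (polys_over A) [:c:] f1"
        then have "divides_in (polys_over A) [:p * c:] f"
          using f1 by (auto simp: divides_in_def)
        then have "divides_in A (p * c) (p * l)" using mult.prems c p subring_setD[OF R] by auto
        then show "divides_in A c l" using p by (auto simp: divides_in_def)
      qed
      then obtain c g where "c \<in> A" "primitive_over A g" "f1 = smult c g" by blast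
      then show ?thesis using p f1 subring_setD(4)[OF R]
        by (intro bexI[of _ "p * c"] exI[of _ g]) auto
    next
      case False
      show ?thesis
      proof (rule mult.IH[OF mult.prems(1)])
        fix c assume c: "c \<in> A" "divides_in (polys_over A) [:c:] f"
        then obtain e where e: "e \<in> A" "p * l = c * e" 
          using mult.prems(2)[OF c] by (auto simp: divides_in_def)
        have "divides_in A p (c * e)"
          unfolding divides_in_def e(2)[symmetric] by (rule bexI[OF refl lA])
        moreover have "\<not> divides_in A p c"
        proof
          assume "divides_in A p c"
          then obtain e' where "e' \<in> A" "c = p * e'" by (auto simp: divides_in_def)
          then have "[:c:] = [:p:] * [:e':]" "[:e':] \<in> polys_over A" using R by auto
          then have "divides_in (polys_over A) [:p:] [:c:]" unfolding divides_in_def by blast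
          then show False using False c divides_in_trans[OF B] by blast
        qed
        ultimately have "divides_in A p e" using mult.hyps(1) c e by (auto simp: prime_in_def)
        then obtain e' where "e' \<in> A" "e = p * e'" by (auto simp: divides_in_def)
        then have "p * l = p * (c * e')" using e by (simp add: ac_simps)
        then show "divides_in A c l" using p \<open>e' \<in> A\<close> by (auto simp: divides_in_def)
      qed
    qed
  qed
  have l: "lead_coeff f \<in> A" "lead_coeff f \<noteq> 0" using f by (auto dest: polys_overD)
  show ?thesis
  proof (rule gen)
    show "prime_product A (lead_coeff f)" using A l by (auto simp: factorial_set_def)
    show "divides_in A c (lead_coeff f)" if "c \<in> A" "divides_in (polys_over A) [:c:] f" for c
      using that const_divides_in_polys_over[OF R _ f(1)] by blast
  qed fact
qed

text \<open>If \<open>f\<close> divides \<open>a * b\<close> but not \<open>a\<close>, then \<open>f\<close> and \<open>a\<close> have no common divisor of positive degree,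
so their ideal contains a nonzero constant \<open>c = u * f + v * a\<close>. Hence \<open>f\<close> divides \<open>c * b\<close>, and
\<open>c\<close> can be cancelled as \<open>f\<close> is primitive.\<close>

lemma irreducible_primitive_imp_prime:
  assumes A: "factorial_set A" and f: "primitive_over A f" "degree f > 0"
    and irr: "\<And>g h. g \<in> polys_over A \<Longrightarrow> h \<in> polys_over A \<Longrightarrow> f = g * h \<Longrightarrow> degree g = 0 \<or> degree h = 0"
  shows "prime_in (polys_over A) f"
proof -
  have R: "subring_set A" using A by (simp add: factorial_set_def)
  note B = subring_set_polys_over[OF R]
  have fB: "f \<in> polys_over A" using f by (simp add: primitive_over_def)
  have "f \<noteq> 0" using f by auto
  have "\<not> divides_in (polys_over A) f 1"
  proof
    assume "divides_in (polys_over A) f 1"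
    then obtain g where "1 = f * g" by (auto simp: divides_in_def)
    then have "degree f = 0" by (metis degree_1 degree_mult_eq mult_zero_left mult_zero_right one_neq_zero
          add_eq_0_iff_both_eq_0)
    then show False using f by simp
  qed
  moreover have "divides_in (polys_over A) f a \<or> divides_in (polys_over A) f b"
    if a: "a \<in> polys_over A" and b: "b \<in> polys_over A" and ab: "divides_in (polys_over A) f (a * b)" for a b
  proof -
    obtain h where h: "h \<in> ideal_gen (polys_over A) {f, a}" "h \<noteq> 0"
      and q: "\<forall>g\<in>{f, a}. \<exists>c\<in>A. c \<noteq> 0 \<and> (\<exists>q\<in>polys_over A. smult c g = q * h)"
      using ideal_min_degree[OF R, of "{f, a}" f] fB a \<open>f \<noteq> 0\<close> by auto
    have hB: "h \<in> polys_over A" using ideal_gen_subset[OF B _ h(1)] fB a by auto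
    from q obtain c1 q1 c2 q2 where c: "c1 \<in> A" "c1 \<noteq> 0" "c2 \<in> A" "c2 \<noteq> 0"
        "q1 \<in> polys_over A" "q2 \<in> polys_over A" "smult c1 f = q1 * h" "smult c2 a = q2 * h"
      by auto
    show ?thesis
    proof (cases "degree h = 0")
      case True
      then obtain c where hc: "h = [:c:]" by (rule degree_eq_zeroE)
      then have cA: "c \<in> A" "c \<noteq> 0" using hB h R by auto
      obtain u v where uv: "u \<in> polys_over A" "v \<in> polys_over A" "h = u * f + v * a"
        using ideal_gen_pair[OF B h(1)] by blast
      obtain e where e: "e \<in> polys_over A" "a * b = f * e" using ab by (auto simp: divides_in_def)
      have "smult c b = h * b" using hc by simp
      also have "\<dots> = u * f * b + v * (a * b)" by (simp add: uv algebra_simps)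
      also have "\<dots> = f * (u * b + v * e)" by (simp add: e algebra_simps)
      finally have "smult c b = f * (u * b + v * e)" .
      then have "divides_in (polys_over A) f b"
        using cancel_constant_primitive[OF R, of c f b "u * b + v * e"] A cA f b uv e
        by (auto simp: factorial_set_def intro: subring_setD[OF B])
      then show ?thesis ..
    next
      case False
      have cA: "prime_product A (c1 * c2)" using c A subring_setD[OF R] by (auto simp: factorial_set_def)
      have "smult (c1 * c2) f = smult c2 q1 * h" "smult (c1 * c2) a = smult c1 q2 * h"
        using c by (metis mult.commute mult_smult_left smult_smult)+
      then have "\<exists>h'\<in>polys_over A. degree h' = degree h \<and> (\<forall>g\<in>{f, a}. divides_in (polys_over A) h' g)"
        using c fB a smult_in_polys_over[OF R] by (intro cancel_constant[OF R cA hB]) blast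
      then obtain h' where h': "h' \<in> polys_over A" "degree h' = degree h" 
        "divides_in (polys_over A) h' f" "divides_in (polys_over A) h' a" by auto
      obtain u where u: "u \<in> polys_over A" "f = h' * u" using h' by (auto simp: divides_in_def)
      have "degree u = 0" using irr[OF h'(1) u] False h' by auto
      then obtain e where ue: "u = [:e:]" by (rule degree_eq_zeroE)
      have e: "e \<in> A" "e \<noteq> 0" using u ue R \<open>f \<noteq> 0\<close> by auto
      have "divides_in A e 1"
      proof (rule ccontr)
        assume "\<not> divides_in A e 1"
        then obtain p where p: "prime_in A p" "divides_in A p e"
          using prime_product_nonunit[of A e] R A e by (auto simp: factorial_set_def)
        then obtain e' where e': "e' \<in> A" "e = p * e'" by (auto simp: divides_in_def)
        have "f = [:p:] * smult e' h'" using u ue e' by (simp add: mult.commute)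
        then have "divides_in (polys_over A) [:p:] f"
          using e' h' smult_in_polys_over[OF R] unfolding divides_in_def by blast
        then show False using p f by (auto simp: primitive_over_def)
      qed
      then obtain e' where e': "e' \<in> A" "1 = e * e'" by (auto simp: divides_in_def)
      have "f * [:e':] = smult (e * e') h'" unfolding u(2) ue by (simp add: mult.commute)
      then have "h' = f * [:e':]" using e' by simp
      moreover have "[:e':] \<in> polys_over A" using e' R by simp
      ultimately have "divides_in (polys_over A) f h'" unfolding divides_in_def by blast
      then show ?thesis using h' divides_in_trans[OF B] by blast
    qed
  qed
  ultimately show ?thesis using fB \<open>f \<noteq> 0\<close> by (auto simp: prime_in_def)
qed

lemma prime_product_const_poly:
  assumes "subring_set A" "prime_product A a"
  shows "prime_product (polys_over A) [:a:]"
  using assms(2)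
proof induction
  case (unit a)
  then obtain e where "e \<in> A" "1 = a * e" by (auto simp: divides_in_def)
  then have "1 = [:a:] * [:e:]" "[:e:] \<in> polys_over A"
    using assms by (auto simp: one_pCons mult.commute)
  then have "divides_in (polys_over A) [:a:] 1" unfolding divides_in_def by blast
  then show ?case using unit assms by (intro prime_product.unit) auto
next
  case (mult p a)
  then have "prime_product (polys_over A) ([:p:] * [:a:])"
    by (intro prime_product.mult prime_in_const_poly assms)
  then show ?case by (simp add: mult.commute)
qed

text \<open>By induction on the degree: the primitive part of a polynomial is either a product of two polynomials of smaller
positive degree, or prime by the previous lemma.\<close>

lemma factorial_set_polys_over:
  assumes A: "factorial_set A"
  shows "factorial_set (polys_over A)"
proof -
  have R: "subring_set A" using A by (simp add: factorial_set_def)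
  note B = subring_set_polys_over[OF R]
  have "prime_product (polys_over A) f" if "f \<in> polys_over A" "f \<noteq> 0" for f
    using that
  proof (induction "degree f" arbitrary: f rule: less_induct)
    case less
    obtain c g where g: "c \<in> A" "primitive_over A g" "f = smult c g"
      using primitive_part[OF A less.prems] by blast
    have c0: "c \<noteq> 0" "g \<noteq> 0" "g \<in> polys_over A" using g less.prems by (auto simp: primitive_over_def)
    have pc: "prime_product (polys_over A) [:c:]"
      using prime_product_const_poly[OF R] A c0 g by (auto simp: factorial_set_def)
    have dg: "degree f = degree g" using g c0 by simp
    have "prime_product (polys_over A) g"
    proof (cases "degree g = 0")
      case True
      then obtain a where "g = [:a:]" by (rule degree_eq_zeroE)
      then show ?thesis
        using prime_product_const_poly[OF R, of a] A c0 R by (auto simp: factorial_set_def)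
    next
      case False
      show ?thesis
      proof (cases "\<exists>u\<in>polys_over A. \<exists>v\<in>polys_over A. g = u * v \<and> degree u > 0 \<and> degree v > 0")
        case True
        then obtain u v where uv: "u \<in> polys_over A" "v \<in> polys_over A" "g = u * v" "degree u > 0" "degree v > 0"
          by blast
        then have "u \<noteq> 0" "v \<noteq> 0" by auto
        then have "degree g = degree u + degree v" using uv by (simp add: degree_mult_eq)
        then show ?thesis
          unfolding uv(3) using uv dg \<open>u \<noteq> 0\<close> \<open>v \<noteq> 0\<close>
          by (intro prime_product_mult[OF B] less.hyps) auto
      next
        case F: False
        have "prime_in (polys_over A) g"
          using F False by (intro irreducible_primitive_imp_prime[OF A g(2)]) auto
        moreover have "prime_product (polys_over A) 1"
          using subring_setD(1)[OF B] by (intro prime_product.unit) (auto simp: divides_in_def)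
        ultimately show ?thesis using prime_product.mult by fastforce
      qed
    qed
    then have "prime_product (polys_over A) ([:c:] * g)" by (rule prime_product_mult[OF B pc])
    then show ?case using g by simp
  qed
  then show ?thesis using B by (auto simp: factorial_set_def)
qed

lemma factorial_set_image:
  fixes \<phi> :: "'a::idom \<Rightarrow> 'b::idom"
  assumes S: "factorial_set S" and inj: "inj_on \<phi> S"
    and h1: "\<phi> 1 = 1" and hd: "\<And>a b. \<phi> (a - b) = \<phi> a - \<phi> b" and hm: "\<And>a b. \<phi> (a * b) = \<phi> a * \<phi> b"
  shows "factorial_set (\<phi> ` S)"
proof -
  have R: "subring_set S" using S by (simp add: factorial_set_def)
  have R': "subring_set (\<phi> ` S)"
    unfolding subring_set_def using subring_setD[OF R] h1
    by (auto simp flip: hd hm)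
  have d: "divides_in (\<phi> ` S) (\<phi> a) (\<phi> b) \<longleftrightarrow> divides_in S a b" if "a \<in> S" "b \<in> S" for a b
  proof
    assume "divides_in (\<phi> ` S) (\<phi> a) (\<phi> b)"
    then obtain c where c: "c \<in> S" "\<phi> b = \<phi> (a * c)" unfolding divides_in_def hm by blast
    then have "b = a * c" by (intro inj_onD[OF inj]) (auto intro: that subring_setD(4)[OF R])
    then show "divides_in S a b" using c(1) by (auto simp: divides_in_def)
  next
    assume "divides_in S a b"
    then show "divides_in (\<phi> ` S) (\<phi> a) (\<phi> b)" by (auto simp: divides_in_def hm)
  qed
  have z: "\<phi> 0 = 0" using hd[of 0 0] by simp
  have one: "divides_in (\<phi> ` S) (\<phi> a) 1 \<longleftrightarrow> divides_in S a 1" if "a \<in> S" for a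
    using d[OF that subring_setD(1)[OF R]] h1 by simp
  have p: "prime_in (\<phi> ` S) (\<phi> p)" if p: "prime_in S p" for p
    unfolding prime_in_def
  proof (intro conjI ballI impI)
    have pS: "p \<in> S" using p by (simp add: prime_in_def)
    then show "\<phi> p \<in> \<phi> ` S" by simp
    show "\<phi> p \<noteq> 0"
    proof
      assume "\<phi> p = 0"
      then have "p = 0" using inj_onD[OF inj, of p 0] z pS subring_setD(2)[OF R] by simp
      then show False using p by (simp add: prime_in_def)
    qed
    show "\<not> divides_in (\<phi> ` S) (\<phi> p) 1" using p one[OF pS] by (simp add: prime_in_def)
    fix x y assume "x \<in> \<phi> ` S" "y \<in> \<phi> ` S" "divides_in (\<phi> ` S) (\<phi> p) (x * y)"
    then obtain a b where ab: "a \<in> S" "b \<in> S" "x = \<phi> a" "y = \<phi> b" "divides_in S p (a * b)"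
      using d[OF pS subring_setD(4)[OF R]] hm by (metis imageE)
    then show "divides_in (\<phi> ` S) (\<phi> p) x \<or> divides_in (\<phi> ` S) (\<phi> p) y"
      using p d[OF pS] unfolding prime_in_def by blast
  qed
  have "prime_product (\<phi> ` S) (\<phi> a)" if "prime_product S a" for a
    using that
  proof induction
    case (unit a)
    then show ?case using one by (intro prime_product.unit) auto
  next
    case (mult q a)
    then show ?case unfolding hm by (intro prime_product.mult p)
  qed
  moreover have "prime_product S a" if "a \<in> S" "\<phi> a \<noteq> 0" for a
    using S z that by (auto simp: factorial_set_def)
  ultimately have "\<forall>x\<in>\<phi> ` S. x \<noteq> 0 \<longrightarrow> prime_product (\<phi> ` S) x" by simp
  then show ?thesis using R' by (simp add: factorial_set_def)
qed

section \<open>Polynomials as univariate polynomials in the last variable\<close>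

definition ring_hom_map :: "('a::comm_ring_1 \<Rightarrow> 'b::comm_ring_1) \<Rightarrow> bool" where
  "ring_hom_map f \<longleftrightarrow> f 1 = 1 \<and> (\<forall>a b. f (a + b) = f a + f b \<and> f (a * b) = f a * f b)"

lemma ring_hom_mapD:
  assumes "ring_hom_map f"
  shows "f 1 = 1" "f (a + b) = f a + f b" "f (a * b) = f a * f b" "f 0 = 0" "f (- a) = - f a"
    "f (a - b) = f a - f b" "f (a ^ n) = f a ^ n" "f (sum g I) = (\<Sum>i\<in>I. f (g i))"
proof -
  show 1: "f 1 = 1" and a: "\<And>a b. f (a + b) = f a + f b" and m: "\<And>a b. f (a * b) = f a * f b"
    using assms by (auto simp: ring_hom_map_def)
  show 0: "f 0 = 0" using a[of 0 0] by simp
  show u: "f (- a) = - f a" for a using a[of a "- a"] 0 by (simp add: eq_neg_iff_add_eq_0 add.commute)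
  show "f (a - b) = f a - f b" using a[of a "- b"] u by simp
  show "f (a ^ n) = f a ^ n" by (induction n) (auto simp: 1 m)
  show "f (sum g I) = (\<Sum>i\<in>I. f (g i))" by (induction I rule: infinite_finite_induct) (auto simp: 0 a)
qed

lemma ring_hom_map_poly:
  assumes "ring_hom_map f"
  shows "ring_hom_map (map_poly f)"
proof -
  note h = ring_hom_mapD[OF assms]
  have "map_poly f (p + q) = map_poly f p + map_poly f q" for p q
    by (rule poly_eqI) (simp add: coeff_map_poly h)
  moreover have "map_poly f (p * q) = map_poly f p * map_poly f q" for p q
    by (rule poly_eqI) (simp add: coeff_map_poly h coeff_mult)
  ultimately show ?thesis by (auto simp: ring_hom_map_def h one_pCons map_poly_pCons)
qed

lemma poly_map_poly_hom:
  assumes "ring_hom_map f"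
  shows "poly (map_poly f p) (f a) = f (poly p a)"
  by (induction p) (auto simp: map_poly_pCons ring_hom_mapD[OF assms])

definition mono_eval :: "(nat \<Rightarrow> 'a::comm_ring_1) \<Rightarrow> (nat \<Rightarrow>\<^sub>0 nat) \<Rightarrow> 'a" where
  "mono_eval v m = (\<Prod>i\<in>Poly_Mapping.keys m. v i ^ Poly_Mapping.lookup m i)"

text \<open>The coefficients are mapped by \<open>f\<close> and the variables are replaced according to \<open>v\<close>. Evaluation, the
passage to rational coefficients and the expansion in powers of one variable are all of this form, so that
they are ring homomorphisms for a single reason.\<close>

definition subst_eval :: "('a::comm_ring_1 \<Rightarrow> 'b::comm_ring_1) \<Rightarrow> (nat \<Rightarrow> 'b) \<Rightarrow> 'a mpoly \<Rightarrow> 'b" where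
  "subst_eval f v P = (\<Sum>m\<in>Poly_Mapping.keys P. f (Poly_Mapping.lookup P m) * mono_eval v m)"

lemma mpoly_eval_conv_subst_eval: "mpoly_eval P x = subst_eval (\<lambda>c. c) x P"
  by (simp add: mpoly_eval_def subst_eval_def mono_eval_def)

lemma mono_eval_superset:
  assumes "finite S" "Poly_Mapping.keys m \<subseteq> S"
  shows "mono_eval v m = (\<Prod>i\<in>S. v i ^ Poly_Mapping.lookup m i)"
  unfolding mono_eval_def using assms
  by (intro prod.mono_neutral_left) (auto simp: in_keys_iff)

lemma mono_eval_add: "mono_eval v (m + m') = mono_eval v m * mono_eval v m'"
proof -
  let ?S = "Poly_Mapping.keys m \<union> Poly_Mapping.keys m'"
  have "Poly_Mapping.keys (m + m') \<subseteq> ?S" by (rule keys_add)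
  then have "mono_eval v (m + m') = (\<Prod>i\<in>?S. v i ^ Poly_Mapping.lookup (m + m') i)"
    by (intro mono_eval_superset) auto
  also have "\<dots> = (\<Prod>i\<in>?S. v i ^ Poly_Mapping.lookup m i) * (\<Prod>i\<in>?S. v i ^ Poly_Mapping.lookup m' i)"
    by (simp add: lookup_add power_add prod.distrib)
  also have "\<dots> = mono_eval v m * mono_eval v m'"
    by (subst (1 2) mono_eval_superset[of ?S]) auto
  finally show ?thesis .
qed

lemma mpoly_sum_monomials:
  "P = (\<Sum>m\<in>Poly_Mapping.keys P. Poly_Mapping.single m (Poly_Mapping.lookup P m))"
  by (rule poly_mapping_eqI) (auto simp: lookup_sum lookup_single when_def in_keys_iff)

lemma subst_eval_superset:
  assumes "finite S" "Poly_Mapping.keys P \<subseteq> S" "ring_hom_map f"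
  shows "subst_eval f v P = (\<Sum>m\<in>S. f (Poly_Mapping.lookup P m) * mono_eval v m)"
  unfolding subst_eval_def using assms
  by (intro sum.mono_neutral_left) (auto simp: in_keys_iff ring_hom_mapD(4))

lemma ring_hom_subst_eval:
  fixes f :: "'a::comm_ring_1 \<Rightarrow> 'b::comm_ring_1"
  assumes f: "ring_hom_map f"
  shows "ring_hom_map (subst_eval f v)"
    and subst_eval_single: "subst_eval f v (Poly_Mapping.single m c) = f c * mono_eval v m"
proof -
  note h = ring_hom_mapD[OF f]
  show s: "subst_eval f v (Poly_Mapping.single m c) = f c * mono_eval v m" for m c
    using subst_eval_superset[OF _ _ f, of "{m}" "Poly_Mapping.single m c"]
    by (simp add: lookup_single)
  have add: "subst_eval f v (P + Q) = subst_eval f v P + subst_eval f v Q" for P Q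
  proof -
    let ?S = "Poly_Mapping.keys P \<union> Poly_Mapping.keys Q"
    have "subst_eval f v (P + Q) = (\<Sum>m\<in>?S. f (Poly_Mapping.lookup (P + Q) m) * mono_eval v m)"
      using keys_add[of P Q] by (intro subst_eval_superset f) auto
    also have "\<dots> = subst_eval f v P + subst_eval f v Q"
      by (subst (1 2) subst_eval_superset[OF _ _ f, of ?S])
        (auto simp: lookup_add h distrib_right sum.distrib)
    finally show ?thesis .
  qed
  have z: "subst_eval f v 0 = 0" by (simp add: subst_eval_def)
  have sum: "subst_eval f v (sum g I) = (\<Sum>i\<in>I. subst_eval f v (g i))"
    for g :: "'i \<Rightarrow> 'a mpoly" and I
    by (induction I rule: infinite_finite_induct) (auto simp: add z)
  have mult: "subst_eval f v (P * Q) = subst_eval f v P * subst_eval f v Q" for P Q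
  proof -
    let ?m = "\<lambda>P m. Poly_Mapping.single m (Poly_Mapping.lookup P m)"
    have "P * Q = (\<Sum>m\<in>Poly_Mapping.keys P. \<Sum>m'\<in>Poly_Mapping.keys Q. ?m P m * ?m Q m')"
      by (subst (1) mpoly_sum_monomials[of P], subst (1) mpoly_sum_monomials[of Q]) (rule sum_product)
    then have "subst_eval f v (P * Q) =
        (\<Sum>m\<in>Poly_Mapping.keys P. \<Sum>m'\<in>Poly_Mapping.keys Q. 
           (f (Poly_Mapping.lookup P m) * mono_eval v m) * (f (Poly_Mapping.lookup Q m') * mono_eval v m'))"
      by (simp add: sum mult_single s h mono_eval_add algebra_simps)
    also have "\<dots> = subst_eval f v P * subst_eval f v Q"
      by (simp add: subst_eval_def sum_product)
    finally show ?thesis .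
  qed
  have "subst_eval f v 1 = 1"
    using s[of 0 1] by (simp add: h mono_eval_def)
  then show "ring_hom_map (subst_eval f v)" by (simp add: ring_hom_map_def add mult)
qed

lemma ring_hom_id: "ring_hom_map (\<lambda>c. c)"
  by (simp add: ring_hom_map_def)

lemma ring_hom_mpoly_eval: "ring_hom_map (\<lambda>P. mpoly_eval P x)" for x :: "nat \<Rightarrow> 'a::comm_ring_1"
  using ring_hom_subst_eval(1)[OF ring_hom_id, of x]
  by (simp add: mpoly_eval_conv_subst_eval[abs_def])

definition mvar :: "nat \<Rightarrow> 'a::comm_ring_1 mpoly" where
  "mvar i = Poly_Mapping.single (Poly_Mapping.single i 1) 1"

lemma mvar_power: "mvar i ^ e = Poly_Mapping.single (Poly_Mapping.single i e) 1"
  by (induction e) (auto simp: mvar_def mult_single simp flip: single_add)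

lemma mono_eval_mvar: "mono_eval mvar m = (Poly_Mapping.single m 1 :: 'a::comm_ring_1 mpoly)"
proof -
  have "(\<Prod>i\<in>S. Poly_Mapping.single (g i) 1) = (Poly_Mapping.single (sum g S) 1 :: 'a mpoly)"
    if "finite S" for S :: "nat set" and g
    using that by induction (auto simp: mult_single)
  moreover have "m = (\<Sum>i\<in>Poly_Mapping.keys m. Poly_Mapping.single i (Poly_Mapping.lookup m i))"
    by (rule poly_mapping_eqI) (auto simp: lookup_sum lookup_single when_def in_keys_iff)
  ultimately show ?thesis by (simp add: mono_eval_def mvar_power)
qed

lemma single_conv_mono_eval:
  "Poly_Mapping.single m c = (Poly_Mapping.single 0 c * mono_eval mvar m :: 'a::comm_ring_1 mpoly)"
  by (simp add: mono_eval_mvar mult_single)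

lemma lookup_rat_mpoly: "Poly_Mapping.lookup (rat_mpoly P) m = of_int (Poly_Mapping.lookup P m)"
  by (simp add: rat_mpoly_def map.rep_eq when_def)

lemma rat_mpoly_eq_0_iff [simp]: "rat_mpoly P = 0 \<longleftrightarrow> P = 0"
  by (simp add: poly_mapping_eq_iff fun_eq_iff lookup_rat_mpoly)

lemma ring_hom_rat_mpoly: "ring_hom_map rat_mpoly"
proof -
  have f: "ring_hom_map (\<lambda>c. Poly_Mapping.single 0 (of_int c) :: rat mpoly)"
    by (simp add: ring_hom_map_def single_add mult_single)
  have "rat_mpoly P = subst_eval (\<lambda>c. Poly_Mapping.single 0 (of_int c)) mvar P" for P
  proof -
    have "Poly_Mapping.keys (rat_mpoly P) = Poly_Mapping.keys P"
      by (auto simp: in_keys_iff lookup_rat_mpoly)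
    then show ?thesis
      by (subst mpoly_sum_monomials[of "rat_mpoly P"])
        (simp add: subst_eval_def lookup_rat_mpoly single_conv_mono_eval[symmetric] del: single_of_int)
  qed
  then have "rat_mpoly = subst_eval (\<lambda>c. Poly_Mapping.single 0 (of_int c)) mvar" by auto
  then show ?thesis using ring_hom_subst_eval(1)[OF f] by metis
qed

lemma mpoly_ringD:
  assumes "P \<in> mpoly_ring n" "m \<in> Poly_Mapping.keys P" "i \<in> Poly_Mapping.keys m"
  shows "1 \<le> i" "i \<le> n"
proof -
  have "i \<in> {1..n}" using assms unfolding mpoly_ring_def by blast
  then show "1 \<le> i" "i \<le> n" by auto
qed

lemma subring_set_mpoly_ring: "subring_set (mpoly_ring n :: 'a::idom mpoly set)"
proof -
  have "P - Q \<in> mpoly_ring n" if "P \<in> mpoly_ring n" "Q \<in> mpoly_ring n" for P Q :: "'a mpoly"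
  proof -
    have "Poly_Mapping.keys (P - Q) \<subseteq> Poly_Mapping.keys P \<union> Poly_Mapping.keys Q"
      by (auto simp: in_keys_iff lookup_minus)
    then show ?thesis using that by (auto simp: mpoly_ring_def)
  qed
  moreover have "P * Q \<in> mpoly_ring n" if "P \<in> mpoly_ring n" "Q \<in> mpoly_ring n" for P Q :: "'a mpoly"
    unfolding mpoly_ring_def
  proof (intro CollectI ballI)
    fix m assume "m \<in> Poly_Mapping.keys (P * Q)"
    then obtain a b where "m = a + b" "a \<in> Poly_Mapping.keys P" "b \<in> Poly_Mapping.keys Q"
      using keys_mult[of P Q] by auto
    then show "Poly_Mapping.keys m \<subseteq> {1..n}"
    proof -
      have "Poly_Mapping.keys a \<subseteq> {1..n}" "Poly_Mapping.keys b \<subseteq> {1..n}"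
        using that \<open>a \<in> _\<close> \<open>b \<in> _\<close> by (simp_all add: mpoly_ring_def)
      then show ?thesis using keys_add[of a b] \<open>m = a + b\<close> by blast
    qed
  qed
  moreover have "(1 :: 'a mpoly) \<in> mpoly_ring n" by (simp add: mpoly_ring_def)
  ultimately show ?thesis unfolding subring_set_def by blast
qed

lemma single_in_mpoly_ring: "Poly_Mapping.keys m \<subseteq> {1..n} \<Longrightarrow> Poly_Mapping.single m c \<in> mpoly_ring n"
  by (cases "c = 0") (auto simp: mpoly_ring_def)

lemma mvar_in_mpoly_ring: "i \<in> {1..n} \<Longrightarrow> mvar i \<in> mpoly_ring n"
  unfolding mvar_def by (rule single_in_mpoly_ring) auto

lemma mpoly_ring_mono: "m \<le> n \<Longrightarrow> mpoly_ring m \<subseteq> mpoly_ring n"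
  by (fastforce simp: mpoly_ring_def)

lemma keys_rat_mpoly: "Poly_Mapping.keys (rat_mpoly P) = Poly_Mapping.keys P"
  by (simp add: set_eq_iff in_keys_iff lookup_rat_mpoly)

lemma rat_mpoly_in_mpoly_ring: "P \<in> mpoly_ring n \<Longrightarrow> rat_mpoly P \<in> mpoly_ring n"
  by (simp add: mpoly_ring_def keys_rat_mpoly)

lemma subring_set_power: "subring_set A \<Longrightarrow> a \<in> A \<Longrightarrow> a ^ k \<in> A"
  by (induction k) (auto intro: subring_setD)

lemma subring_set_prod:
  assumes "subring_set A" "\<And>i. i \<in> I \<Longrightarrow> f i \<in> A"
  shows "prod f I \<in> A"
  using assms(2) by (induction I rule: infinite_finite_induct) (auto intro: subring_setD[OF assms(1)])

text \<open>Expansion in powers of \<open>mvar n\<close>. On polynomials in the first \<open>n\<close> variables, with $n \ge 1$, it is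
inverse to evaluating a univariate polynomial with coefficients in the first $n - 1$ variables at \<open>mvar n\<close>.\<close>

definition mpoly_to_poly :: "nat \<Rightarrow> 'a::comm_ring_1 mpoly \<Rightarrow> 'a mpoly poly" where
  "mpoly_to_poly n =
     subst_eval (\<lambda>c. [:Poly_Mapping.single 0 c:]) (\<lambda>i. if i = n then [:0, 1:] else [:mvar i:])"

lemma ring_hom_const_poly: "ring_hom_map (\<lambda>c. [:Poly_Mapping.single 0 c :: 'a::comm_ring_1 mpoly:])"
  by (simp add: ring_hom_map_def single_add mult_single one_pCons mult.commute)

lemmas ring_hom_mpoly_to_poly =
  ring_hom_subst_eval(1)[OF ring_hom_const_poly, of "\<lambda>i. if i = n then [:0, 1:] else [:mvar i:]" for n,
    folded mpoly_to_poly_def]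

lemma poly_mpoly_to_poly:
  fixes P :: "'a::comm_ring_1 mpoly"
  shows "poly (mpoly_to_poly n P) (mvar n) = P"
proof -
  note s = subst_eval_single[OF ring_hom_const_poly,
      of "\<lambda>i. if i = n then [:0, 1:] else [:mvar i:]", folded mpoly_to_poly_def]
  have "poly (mpoly_to_poly n (Poly_Mapping.single m c)) (mvar n) = Poly_Mapping.single m (c :: 'a)" for m c
  proof -
    have "poly (mono_eval (\<lambda>i. if i = n then [:0, 1:] else [:mvar i:]) m) (mvar n) = (mono_eval mvar m :: 'a mpoly)"
      unfolding mono_eval_def by (auto simp: poly_prod poly_power intro!: prod.cong)
    then have "poly (mpoly_to_poly n (Poly_Mapping.single m c)) (mvar n) =
        Poly_Mapping.single 0 c * mono_eval mvar m" by (simp add: s)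
    then show ?thesis by (simp only: single_conv_mono_eval[of m c])
  qed
  then have "poly (mpoly_to_poly n (\<Sum>m\<in>Poly_Mapping.keys P. Poly_Mapping.single m (Poly_Mapping.lookup P m)))
      (mvar n) = (\<Sum>m\<in>Poly_Mapping.keys P. Poly_Mapping.single m (Poly_Mapping.lookup P m))"
    by (simp add: ring_hom_mapD(8)[OF ring_hom_mpoly_to_poly] poly_sum)
  then show ?thesis by (simp only: mpoly_sum_monomials[of P, symmetric])
qed

lemma mpoly_to_poly_in_polys_over:
  fixes P :: "'a::idom mpoly"
  assumes "P \<in> mpoly_ring (Suc n)"
  shows "mpoly_to_poly (Suc n) P \<in> polys_over (mpoly_ring n)"
proof -
  have R: "subring_set (mpoly_ring n :: 'a mpoly set)" by (rule subring_set_mpoly_ring)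
  note B = subring_set_polys_over[OF R]
  have v: "(if i = Suc n then [:0, 1:] else [:mvar i:]) \<in> polys_over (mpoly_ring n :: 'a mpoly set)"
    if "i \<in> {1..Suc n}" for i
  proof (cases "i = Suc n")
    case True
    then show ?thesis using subring_setD[OF R] by (auto simp: polys_over_def coeff_pCons split: nat.splits)
  next
    case False
    then show ?thesis using R that mvar_in_mpoly_ring[of i n] by auto
  qed
  show ?thesis unfolding mpoly_to_poly_def subst_eval_def mono_eval_def
  proof (intro subring_set_sum[OF B] subring_setD(4)[OF B] subring_set_prod[OF B] subring_set_power[OF B])
    fix m i assume "m \<in> Poly_Mapping.keys P" "i \<in> Poly_Mapping.keys m"
    then have "i \<in> {1..Suc n}" using mpoly_ringD[OF assms] by auto
    then show "(if i = Suc n then [:0, 1:] else [:mvar i:]) \<in> polys_over (mpoly_ring n :: 'a mpoly set)"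
      by (rule v)
  qed (use R in \<open>auto intro: single_in_mpoly_ring\<close>)
qed

lemma mpoly_to_poly_const:
  fixes P :: "'a::idom mpoly"
  assumes "P \<in> mpoly_ring n"
  shows "mpoly_to_poly (Suc n) P = [:P:]"
proof -
  have pr: "(\<Prod>i\<in>S. [:g i:] ^ e i) = [:\<Prod>i\<in>S. g i ^ e i :: 'a mpoly:]" for S :: "nat set" and g e
    by (induction S rule: infinite_finite_induct) (auto simp: one_pCons poly_const_pow)
  have m: "mono_eval (\<lambda>i. if i = Suc n then [:0, 1:] else [:mvar i:]) m = [:mono_eval mvar m :: 'a mpoly:]"
    if "m \<in> Poly_Mapping.keys P" for m
  proof -
    have "i \<noteq> Suc n" if "i \<in> Poly_Mapping.keys m" for i
      using mpoly_ringD[OF assms \<open>m \<in> _\<close> that] by auto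
    then show ?thesis unfolding mono_eval_def by (subst pr[symmetric]) (auto intro!: prod.cong)
  qed
  have "mpoly_to_poly (Suc n) P =
      (\<Sum>m\<in>Poly_Mapping.keys P. [:Poly_Mapping.single m (Poly_Mapping.lookup P m):])"
    unfolding mpoly_to_poly_def subst_eval_def
    by (rule sum.cong) (auto simp: m mono_eval_mvar mult_single)
  also have "\<dots> = [:\<Sum>m\<in>Poly_Mapping.keys P. Poly_Mapping.single m (Poly_Mapping.lookup P m):]"
    by (rule poly_eqI) (auto simp: coeff_sum coeff_pCons split: nat.splits)
  finally show ?thesis by (simp only: mpoly_sum_monomials[of P, symmetric])
qed

lemma mpoly_to_poly_poly:
  fixes f :: "'a::idom mpoly poly"
  assumes "f \<in> polys_over (mpoly_ring n)"
  shows "mpoly_to_poly (Suc n) (poly f (mvar (Suc n))) = f"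
proof -
  note h = ring_hom_mapD[OF ring_hom_mpoly_to_poly]
  have x: "mpoly_to_poly (Suc n) (mvar (Suc n)) = [:0, 1 :: 'a mpoly:]"
    unfolding mpoly_to_poly_def mvar_def
    by (subst subst_eval_single[OF ring_hom_const_poly]) (simp add: mono_eval_def one_pCons)
  have "mpoly_to_poly (Suc n) (poly f (mvar (Suc n))) = (\<Sum>i\<le>degree f. [:coeff f i:] * [:0, 1:] ^ i)"
    unfolding poly_altdef
    by (simp add: h x mpoly_to_poly_const[OF polys_overD[OF assms]])
  also have "\<dots> = f"
    using poly_as_sum_of_monoms[of f] by (simp add: monom_altdef)
  finally show ?thesis .
qed

lemma poly_mvar_in_mpoly_ring:
  fixes f :: "'a::idom mpoly poly"
  assumes "f \<in> polys_over (mpoly_ring n)"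
  shows "poly f (mvar (Suc n)) \<in> mpoly_ring (Suc n)"
proof -
  have R: "subring_set (mpoly_ring (Suc n) :: 'a mpoly set)" by (rule subring_set_mpoly_ring)
  show ?thesis unfolding poly_altdef
  proof (intro subring_set_sum[OF R] subring_setD(4)[OF R] subring_set_power[OF R])
    show "coeff f i \<in> mpoly_ring (Suc n)" for i
      using polys_overD[OF assms, of i] mpoly_ring_mono[of n "Suc n"] by auto
  qed (auto intro: mvar_in_mpoly_ring)
qed

lemma mpoly_ring_Suc:
  "(mpoly_ring (Suc n) :: 'a::idom mpoly set) = (\<lambda>f. poly f (mvar (Suc n))) ` polys_over (mpoly_ring n)"
proof (intro equalityI subsetI)
  fix P :: "'a mpoly" assume "P \<in> mpoly_ring (Suc n)"
  then show "P \<in> (\<lambda>f. poly f (mvar (Suc n))) ` polys_over (mpoly_ring n)"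
    using poly_mpoly_to_poly[of "Suc n" P] mpoly_to_poly_in_polys_over[of P n] by force
qed (auto intro: poly_mvar_in_mpoly_ring)

lemma mpoly_ring_0:
  assumes "P \<in> mpoly_ring 0"
  shows "P = Poly_Mapping.single 0 (Poly_Mapping.lookup P 0)"
proof (rule poly_mapping_eqI)
  fix m
  have "m \<notin> Poly_Mapping.keys P" if "m \<noteq> 0"
  proof
    assume "m \<in> Poly_Mapping.keys P"
    then have "Poly_Mapping.keys m = {}" using mpoly_ringD[OF assms] by fastforce
    then have "Poly_Mapping.lookup m i = 0" for i by (metis empty_iff in_keys_iff)
    then have "m = 0" by (intro poly_mapping_eqI) simp
    then show False using that by blast
  qed
  then show "Poly_Mapping.lookup P m = Poly_Mapping.lookup (Poly_Mapping.single 0 (Poly_Mapping.lookup P 0)) m"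
    by (cases "m = 0") (simp_all add: in_keys_iff lookup_single)
qed

text \<open>Over a field the nonzero constants are units, and each further variable is one step from \<open>A\<close> to $A[t]$.\<close>

lemma factorial_set_mpoly_ring: "factorial_set (mpoly_ring n :: 'a::field mpoly set)"
proof (induction n)
  case 0
  have "prime_product (mpoly_ring 0) P" if P: "P \<in> mpoly_ring 0" "P \<noteq> 0" for P :: "'a mpoly"
  proof (rule prime_product.unit[OF P(1)])
    let ?c = "Poly_Mapping.lookup P 0"
    have c: "P = Poly_Mapping.single 0 ?c" using mpoly_ring_0 P by blast
    then have "?c \<noteq> 0" using P by (metis single_zero)
    then have "P * Poly_Mapping.single 0 (inverse ?c) = 1"
      by (subst c) (simp add: mult_single)
    then show "divides_in (mpoly_ring 0) P 1"
      unfolding divides_in_def by (metis single_in_mpoly_ring keys_zero empty_subsetI)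
  qed
  then show ?case by (simp add: factorial_set_def subring_set_mpoly_ring)
next
  case (Suc n)
  show ?case unfolding mpoly_ring_Suc
  proof (rule factorial_set_image[OF factorial_set_polys_over[OF Suc]])
    show "inj_on (\<lambda>f. poly f (mvar (Suc n))) (polys_over (mpoly_ring n :: 'a mpoly set))"
      by (rule inj_on_inverseI[of _ "mpoly_to_poly (Suc n)"]) (rule mpoly_to_poly_poly)
  qed simp_all
qed

section \<open>Elimination of the last variable\<close>

definition coprime_family :: "nat \<Rightarrow> int mpoly set \<Rightarrow> bool" where
  "coprime_family n U \<longleftrightarrow> (\<forall>D\<in>mpoly_ring n.
     (\<forall>P\<in>U. mpoly_divides n D (rat_mpoly P)) \<longrightarrow> mpoly_divides n D 1)"

lemma mpoly_divides_conv: "mpoly_divides n D P \<longleftrightarrow> divides_in (mpoly_ring n) D P"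
  by (simp add: mpoly_divides_def divides_in_def)

lemma coprime_family_nonzero:
  assumes "coprime_family n U"
  shows "\<exists>P\<in>U. P \<noteq> 0"
proof (rule ccontr)
  assume "\<not> ?thesis"
  then have "\<forall>P\<in>U. mpoly_divides n 0 (rat_mpoly P)"
    using subring_setD(2)[OF subring_set_mpoly_ring[where ?'a = rat]]
    by (simp add: mpoly_divides_def) blast
  then have "mpoly_divides n 0 (1 :: rat mpoly)"
    using assms subring_setD(2)[OF subring_set_mpoly_ring[where ?'a = rat]]
    unfolding coprime_family_def by blast
  then show False by (auto simp: mpoly_divides_def)
qed

lemma rat_mpoly_mvar [simp]: "rat_mpoly (mvar i) = mvar i"
  by (simp add: mvar_def rat_mpoly_def)

lemma divides_in_poly_mvar:
  assumes "f \<in> polys_over (mpoly_ring n)" "divides_in (polys_over (mpoly_ring n)) f g"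
  shows "mpoly_divides (Suc n) (poly f (mvar (Suc n))) (poly g (mvar (Suc n) :: 'a::idom mpoly))"
  using assms unfolding divides_in_def mpoly_divides_def
  using poly_mvar_in_mpoly_ring by fastforce

lemma divides_in_unit_degree:
  fixes h :: "'a::idom mpoly poly"
  assumes "h \<in> polys_over (mpoly_ring n)" "mpoly_divides (Suc n) (poly h (mvar (Suc n))) 1"
  shows "divides_in (polys_over (mpoly_ring n)) h 1"
proof -
  obtain E where E: "E \<in> mpoly_ring (Suc n)" "1 = poly h (mvar (Suc n)) * E"
    using assms(2) by (auto simp: mpoly_divides_def)
  have "mpoly_to_poly (Suc n) 1 = h * mpoly_to_poly (Suc n) E"
    by (simp add: E(2) ring_hom_mapD[OF ring_hom_mpoly_to_poly] mpoly_to_poly_poly[OF assms(1)])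
  then have "1 = h * mpoly_to_poly (Suc n) E" by (simp add: ring_hom_mapD[OF ring_hom_mpoly_to_poly])
  then show ?thesis using mpoly_to_poly_in_polys_over[OF E(1)] by (auto simp: divides_in_def)
qed

text \<open>A nonzero element \<open>h\<close> of least degree in the last variable does the job if that degree is zero. A positive degree
is impossible: \<open>h\<close> divides all members of \<open>U\<close> up to a common constant factor, and after this factor is
cancelled over $\mathbb{Q}$ there remains a common divisor of positive degree. The ideal is formed over $\mathbb{Z}$,
so that divisibility of all the values of \<open>U\<close> by an integer passes on to the values of $R$.\<close>

lemma elimination:
  assumes fin: "finite U" and U: "U \<subseteq> mpoly_ring (Suc n)" and cop: "coprime_family (Suc n) U"
  shows "\<exists>R\<in>mpoly_ring n. R \<noteq> 0 \<and> R \<in> ideal_gen (mpoly_ring (Suc n)) U"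
proof -
  let ?A = "mpoly_ring n :: int mpoly set" and ?Q = "mpoly_ring n :: rat mpoly set"
  have R: "subring_set ?A" and RQ: "subring_set ?Q" by (rule subring_set_mpoly_ring)+
  let ?T = "mpoly_to_poly (Suc n)" and ?x = "mvar (Suc n) :: int mpoly"
  obtain P0 where P0: "P0 \<in> U" "P0 \<noteq> 0" using coprime_family_nonzero[OF cop] by blast
  have sub: "?T ` U \<subseteq> polys_over ?A" using U mpoly_to_poly_in_polys_over by blast
  have "?T P0 \<noteq> 0" using P0 poly_mpoly_to_poly[of "Suc n" P0] by auto
  with ideal_min_degree[OF R sub, of "?T P0"] P0
  obtain h where h: "h \<in> ideal_gen (polys_over ?A) (?T ` U)" "h \<noteq> 0"
    and "\<forall>P\<in>U. \<exists>a\<in>?A. a \<noteq> 0 \<and> (\<exists>q\<in>polys_over ?A. smult a (?T P) = q * h)" by blast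
  then obtain a q where aq: "\<And>P. P \<in> U \<Longrightarrow>
      a P \<in> ?A \<and> a P \<noteq> 0 \<and> q P \<in> polys_over ?A \<and> smult (a P) (?T P) = q P * h" by metis
  have hA: "h \<in> polys_over ?A" using ideal_gen_subset[OF subring_set_polys_over[OF R] sub h(1)] .
  show ?thesis
  proof (cases "degree h = 0")
    case True
    then obtain r where r: "h = [:r:]" by (rule degree_eq_zeroE)
    have "poly f ?x \<in> ideal_gen (mpoly_ring (Suc n)) U" if "f \<in> ideal_gen (polys_over ?A) (?T ` U)" for f
      using that
      by induction (auto simp: poly_mpoly_to_poly intro: ideal_gen.intros poly_mvar_in_mpoly_ring)
    from this[OF h(1)] show ?thesis using r h hA R by auto
  next
    case False
    define c where "c = (\<Prod>P\<in>U. a P)"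
    have c: "c \<in> ?A" "c \<noteq> 0"
      using aq fin by (auto simp: c_def intro: subring_set_prod[OF R])
    let ?r = "map_poly rat_mpoly"
    note rh = ring_hom_mapD[OF ring_hom_rat_mpoly] ring_hom_mapD[OF ring_hom_map_poly[OF ring_hom_rat_mpoly]]
    have rA: "?r f \<in> polys_over ?Q" if "f \<in> polys_over ?A" for f
      using that by (auto simp: polys_over_def coeff_map_poly rh intro: rat_mpoly_in_mpoly_ring)
    have cdiv: "\<exists>q\<in>polys_over ?A. smult c (?T P) = q * h" if P: "P \<in> U" for P
    proof -
      have "c = prod a (U - {P}) * a P" using fin P by (simp add: c_def prod.remove mult.commute)
      then have "smult c (?T P) = smult (prod a (U - {P})) (q P) * h" using aq[OF P]
        by (simp flip: smult_smult)
      moreover have "smult (prod a (U - {P})) (q P) \<in> polys_over ?A"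
        using aq P by (intro smult_in_polys_over[OF R] subring_set_prod[OF R]) auto
      ultimately show ?thesis by blast
    qed
    have "prime_product ?Q (rat_mpoly c)"
      using factorial_set_mpoly_ring[where ?'a = rat and n = n] c rat_mpoly_in_mpoly_ring[of c n]
      unfolding factorial_set_def by simp
    moreover have "\<forall>f\<in>?r ` ?T ` U. f \<in> polys_over ?Q \<and> (\<exists>q\<in>polys_over ?Q. smult (rat_mpoly c) f = q * ?r h)"
    proof (intro ballI conjI)
      fix f assume "f \<in> ?r ` ?T ` U"
      then obtain P where P: "P \<in> U" "f = ?r (?T P)" by blast
      show "f \<in> polys_over ?Q" using P sub rA by blast
      obtain q where "q \<in> polys_over ?A" "smult c (?T P) = q * h" using cdiv[OF P(1)] by blast
      moreover have "?r (smult c (?T P)) = smult (rat_mpoly c) f"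
        unfolding P by (rule poly_eqI) (simp add: coeff_map_poly rh)
      ultimately show "\<exists>q\<in>polys_over ?Q. smult (rat_mpoly c) f = q * ?r h"
        using rA rh by metis
    qed
    ultimately obtain h' where h': "h' \<in> polys_over ?Q" "degree h' = degree (?r h)"
      "\<forall>f\<in>?r ` ?T ` U. divides_in (polys_over ?Q) h' f"
      using cancel_constant[OF RQ _ rA[OF hA]] by metis
    have dr: "degree (?r h) = degree h" by (rule degree_map_poly) simp
    have "mpoly_divides (Suc n) (poly h' (mvar (Suc n))) (rat_mpoly P)" if P: "P \<in> U" for P
    proof -
      have "poly (?r (?T P)) (mvar (Suc n)) = rat_mpoly P"
        using poly_map_poly_hom[OF ring_hom_rat_mpoly, of "?T P" ?x] by (simp add: poly_mpoly_to_poly)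
      then show ?thesis using divides_in_poly_mvar[OF h'(1), of "?r (?T P)"] h'(3) P by auto
    qed
    then have "mpoly_divides (Suc n) (poly h' (mvar (Suc n))) 1"
      using cop poly_mvar_in_mpoly_ring[OF h'(1)] by (simp add: coprime_family_def)
    then have "divides_in (polys_over ?Q) h' 1" by (rule divides_in_unit_degree[OF h'(1)])
    then obtain e where "1 = h' * e" by (auto simp: divides_in_def)
    then have "degree h' = 0" by (metis add_eq_0_iff_both_eq_0 degree_1 degree_mult_eq mult_zero_left mult_zero_right one_neq_zero)
    then show ?thesis using False h' dr by simp
  qed
qed

text \<open>A polynomial without the last variable that divides all the coefficients divides the members of \<open>U\<close> as well. This
is what allows the induction on the number of variables in the tail estimate.\<close>

lemma coprime_family_coeffs:
  assumes "coprime_family (Suc n) U" 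
  shows "coprime_family n (\<Union>P\<in>U. range (coeff (mpoly_to_poly (Suc n) P)))"
  unfolding coprime_family_def
proof (intro ballI impI)
  fix D :: "rat mpoly"
  assume D: "D \<in> mpoly_ring n" 
    and div: "\<forall>P\<in>\<Union>P\<in>U. range (coeff (mpoly_to_poly (Suc n) P)). mpoly_divides n D (rat_mpoly P)"
  let ?Q = "mpoly_ring n :: rat mpoly set"
  note R = subring_set_mpoly_ring[where ?'a = rat]
  note rh = ring_hom_mapD[OF ring_hom_rat_mpoly]
  have D': "[:D:] \<in> polys_over ?Q" using D R by simp
  have "mpoly_divides (Suc n) D (rat_mpoly P)" if P: "P \<in> U" for P
  proof -
    let ?f = "map_poly rat_mpoly (mpoly_to_poly (Suc n) P)"
    have d: "divides_in ?Q D (coeff ?f i)" for i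
      using div P by (auto simp: coeff_map_poly rh mpoly_divides_conv)
    then have "coeff ?f i \<in> ?Q" for i
      using subring_setD(4)[OF R D] by (metis divides_in_def)
    then have "?f \<in> polys_over ?Q" by (simp add: polys_over_def)
    then have "divides_in (polys_over ?Q) [:D:] ?f"
      using const_divides_in_polys_over[OF R D] d by blast
    from divides_in_poly_mvar[OF D' this]
    show ?thesis
      using poly_map_poly_hom[OF ring_hom_rat_mpoly, of "mpoly_to_poly (Suc n) P" "mvar (Suc n)"]
      by (simp add: poly_mpoly_to_poly)
  qed
  then have "mpoly_divides (Suc n) (poly [:D:] (mvar (Suc n))) 1"
    using assms subsetD[OF mpoly_ring_mono[of n "Suc n"] D] by (simp add: coprime_family_def)
  then have "divides_in (polys_over ?Q) [:D:] 1" by (rule divides_in_unit_degree[OF D'])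
  then show "mpoly_divides n D 1"
    using const_divides_in_polys_over[OF R D, of 1] subring_setD(1)[OF subring_set_polys_over[OF R]]
    by (auto simp: mpoly_divides_conv dest: spec[of _ 0])
qed

section \<open>Zeros modulo a prime in a box\<close>

text \<open>Lagrange's bound for the number of roots in a field, in a finite set \<open>B\<close> of integers that meets each
residue class modulo \<open>p\<close> in at most \<open>c\<close> points.\<close>

lemma card_roots_mod_prime:
  fixes f :: "int poly" and p :: nat
  assumes p: "prime p" and f: "\<exists>i. \<not> int p dvd coeff f i" and B: "finite B"
    and c: "\<And>a. card {b\<in>B. [b = a] (mod int p)} \<le> c"
  shows "card {b\<in>B. int p dvd poly f b} \<le> degree f * c"
  using f
proof (induction "degree f" arbitrary: f rule: less_induct)
  case less
  show ?case
  proof (cases "\<exists>b0\<in>B. int p dvd poly f b0")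
    case False
    then have "{b\<in>B. int p dvd poly f b} = {}" by blast
    then show ?thesis by (simp only: card.empty zero_le)
  next
    case True
    then obtain b0 where b0: "b0 \<in> B" "int p dvd poly f b0" by blast
    define g where "g = synthetic_div f b0"
    have fg: "f = [:-b0, 1:] * g + [:poly f b0:]"
      unfolding g_def by (rule synthetic_div_correct'[symmetric])
    have "degree f \<noteq> 0"
    proof
      assume "degree f = 0"
      then obtain a where a: "f = [:a:]" by (rule degree_eq_zeroE)
      then have "int p dvd coeff f i" for i using b0 by (cases i) auto
      then show False using less.prems by blast
    qed
    then have dg: "degree f = Suc (degree g)" by (simp add: g_def degree_synthetic_div)
    have "\<exists>i. \<not> int p dvd coeff g i"
    proof (rule ccontr)
      assume "\<not> ?thesis"
      then have "int p dvd coeff f i" for i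
        by (subst fg) (cases i; use b0 in \<open>auto simp: coeff_pCons split: nat.splits\<close>)
      then show False using less.prems by blast
    qed
    then have IH: "card {b\<in>B. int p dvd poly g b} \<le> degree g * c"
      using less.hyps dg by simp
    have "{b\<in>B. int p dvd poly f b} \<subseteq> {b\<in>B. [b = b0] (mod int p)} \<union> {b\<in>B. int p dvd poly g b}"
    proof
      fix b assume b: "b \<in> {b\<in>B. int p dvd poly f b}"
      have "poly f b = (b - b0) * poly g b + poly f b0"
        using arg_cong[OF fg, of "\<lambda>f. poly f b"] by (simp add: algebra_simps)
      then have "int p dvd (b - b0) * poly g b" using b b0 by (simp add: dvd_add_left_iff)
      then have "int p dvd b - b0 \<or> int p dvd poly g b"
        using p by (simp add: prime_dvd_mult_iff)
      then show "b \<in> {b\<in>B. [b = b0] (mod int p)} \<union> {b\<in>B. int p dvd poly g b}"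
        using b by (auto simp: cong_iff_dvd_diff)
    qed
    then have "card {b\<in>B. int p dvd poly f b} \<le>
        card ({b\<in>B. [b = b0] (mod int p)} \<union> {b\<in>B. int p dvd poly g b})"
      by (intro card_mono) (use B in auto)
    also have "\<dots> \<le> c + degree g * c"
      by (rule order.trans[OF card_Un_le]) (intro add_mono c IH)
    finally show ?thesis by (simp add: dg)
  qed
qed

text \<open>The restriction of \<open>P\<close> to a line parallel to the last axis.\<close>

definition specialize :: "nat \<Rightarrow> int mpoly \<Rightarrow> (nat \<Rightarrow> int) \<Rightarrow> int poly" where
  "specialize n P x = map_poly (\<lambda>c. mpoly_eval c x) (mpoly_to_poly (Suc n) P)"

lemma mpoly_eval_mvar [simp]: "mpoly_eval (mvar i) x = (x i :: 'a::comm_ring_1)"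
  unfolding mpoly_eval_conv_subst_eval mvar_def
  by (simp add: subst_eval_single[OF ring_hom_id] mono_eval_def)

lemma mpoly_eval_ring_0:
  fixes P :: "'a::comm_ring_1 mpoly"
  assumes "P \<in> mpoly_ring 0"
  shows "mpoly_eval P x = Poly_Mapping.lookup P 0"
  by (subst mpoly_ring_0[OF assms], subst mpoly_eval_conv_subst_eval, subst subst_eval_single[OF ring_hom_id])
    (simp add: mono_eval_def)

lemma mpoly_eval_cong:
  assumes "P \<in> mpoly_ring n" "\<And>i. i \<in> {1..n} \<Longrightarrow> x i = y i"
  shows "mpoly_eval P x = mpoly_eval P y"
  unfolding mpoly_eval_def
  using mpoly_ringD[OF assms(1)] assms(2)
  by (intro sum.cong prod.cong arg_cong2[of _ _ _ _ "(*)"] arg_cong2[of _ _ _ _ "(^)"]) auto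

lemma coeff_specialize: "coeff (specialize n P x) j = mpoly_eval (coeff (mpoly_to_poly (Suc n) P) j) x"
  by (simp add: specialize_def coeff_map_poly ring_hom_mapD[OF ring_hom_mpoly_eval])

lemma degree_specialize: "degree (specialize n P x) \<le> degree (mpoly_to_poly (Suc n) P)"
  by (intro degree_le) (auto simp: coeff_specialize coeff_eq_0 ring_hom_mapD[OF ring_hom_mpoly_eval])

lemma poly_specialize:
  assumes P: "P \<in> mpoly_ring (Suc n)"
  shows "poly (specialize n P x) b = mpoly_eval P (x(Suc n := b))"
proof -
  let ?y = "x(Suc n := b)"
  have "specialize n P x = map_poly (\<lambda>c. mpoly_eval c ?y) (mpoly_to_poly (Suc n) P)"
  proof (rule poly_eqI)
    fix j
    have "mpoly_eval (coeff (mpoly_to_poly (Suc n) P) j) x = mpoly_eval (coeff (mpoly_to_poly (Suc n) P) j) ?y"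
      using polys_overD[OF mpoly_to_poly_in_polys_over[OF P]] by (rule mpoly_eval_cong) auto
    then show "coeff (specialize n P x) j = coeff (map_poly (\<lambda>c. mpoly_eval c ?y) (mpoly_to_poly (Suc n) P)) j"
      by (simp add: coeff_specialize coeff_map_poly ring_hom_mapD[OF ring_hom_mpoly_eval])
  qed
  then show ?thesis
    using poly_map_poly_hom[OF ring_hom_mpoly_eval, of ?y "mpoly_to_poly (Suc n) P" "mvar (Suc n)"]
    by (simp add: poly_mpoly_to_poly)
qed

lemma card_PiE_Suc:
  assumes "finite B"
  shows "card {x \<in> {1..Suc n} \<rightarrow>\<^sub>E B. Q x} = (\<Sum>x\<in>{1..n} \<rightarrow>\<^sub>E B. card {b\<in>B. Q (x(Suc n := b))})"
proof -
  let ?S = "SIGMA x:{1..n} \<rightarrow>\<^sub>E B. {b\<in>B. Q (x(Suc n := b))}"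
  let ?g = "\<lambda>(x, b). x(Suc n := b)"
  have ins: "{1..Suc n} = insert (Suc n) {1..n}" by auto
  have "{x \<in> {1..Suc n} \<rightarrow>\<^sub>E B. Q x} = ?g ` ?S"
    unfolding ins PiE_insert_eq by auto
  moreover have "inj_on ?g ?S"
    using inj_combinator[of "Suc n" "{1..n}" "\<lambda>_. B"]
    by (auto simp: inj_on_def Ball_def)
  ultimately have "card {x \<in> {1..Suc n} \<rightarrow>\<^sub>E B. Q x} = card ?S" by (simp add: card_image)
  also have "\<dots> = (\<Sum>x\<in>{1..n} \<rightarrow>\<^sub>E B. card {b\<in>B. Q (x(Suc n := b))})"
    using assms by (subst card_SigmaI) (auto intro: finite_PiE)
  finally show ?thesis .
qed

lemma card_box: "card ({1..n} \<rightarrow>\<^sub>E B) = card B ^ n" for n :: nat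
  by (simp add: card_funcsetE)

lemma of_int_conv_single: "(of_int a :: int mpoly) = Poly_Mapping.single 0 a"
  by (metis of_int_eq_id id_apply single_of_int)

lemma of_int_dvd_imp_dvd_lookup:
  assumes "of_int a dvd (P :: int mpoly)"
  shows "a dvd Poly_Mapping.lookup P m"
proof -
  obtain Q where "P = of_int a * Q" using assms by blast
  then have "P = Poly_Mapping.map ((*) a) Q"
    by (simp only: mult_map_scale_conv_mult of_int_conv_single)
  then show ?thesis by (simp add: map.rep_eq when_def)
qed

text \<open>The Schwartz--Zippel bound with a constant that depends only on $R$: the zeros of $R$ modulo \<open>p\<close> are a
proportion of at most $C c / |B|$ of the box. Both sides carry a factor $|B|$ in order to stay within the natural
numbers. In the induction, some coefficient with respect to the last variable is nonzero modulo \<open>p\<close>; outside its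
zeros Lagrange's bound applies on each line.\<close>

lemma schwartz_zippel_mod_prime:
  assumes "R \<in> mpoly_ring n"
  shows "\<exists>C. \<forall>p B c. prime p \<longrightarrow> \<not> of_int (int p) dvd R \<longrightarrow> finite B \<longrightarrow>
           (\<forall>a. card {b\<in>B. [b = a] (mod int p)} \<le> c) \<longrightarrow>
           card {x \<in> {1..n} \<rightarrow>\<^sub>E B. int p dvd mpoly_eval R x} * card B \<le> C * c * card B ^ n"
  using assms
proof (induction n arbitrary: R)
  case 0
  let ?c = "Poly_Mapping.lookup R 0"
  have R: "R = Poly_Mapping.single 0 ?c" using mpoly_ring_0 0 by blast
  have ev: "mpoly_eval R x = ?c" for x using 0 by (rule mpoly_eval_ring_0)
  have "{x \<in> {1..0} \<rightarrow>\<^sub>E B. int p dvd mpoly_eval R x} = {}" if "\<not> of_int (int p) dvd R" for p :: nat and B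
  proof -
    have "\<not> int p dvd ?c"
    proof
      assume "int p dvd ?c"
      then obtain e where "?c = int p * e" by blast
      then have "R = Poly_Mapping.single 0 (int p) * Poly_Mapping.single 0 e"
        by (subst R) (simp add: mult_single del: single_of_int single_of_nat)
      then show False using that unfolding of_int_conv_single by (metis dvd_triv_left)
    qed
    then show ?thesis by (auto simp: ev)
  qed
  then show ?case by (intro exI[of _ 0]) auto
next
  case (Suc n)
  let ?T = "mpoly_to_poly (Suc n) R"
  have "coeff ?T j \<in> mpoly_ring n" for j
    using polys_overD[OF mpoly_to_poly_in_polys_over[OF Suc.prems]] .
  then have "\<exists>C. \<forall>j p B c. prime p \<longrightarrow> \<not> of_int (int p) dvd coeff ?T j \<longrightarrow> finite B \<longrightarrow>
           (\<forall>a. card {b\<in>B. [b = a] (mod int p)} \<le> c) \<longrightarrow>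
           card {x \<in> {1..n} \<rightarrow>\<^sub>E B. int p dvd mpoly_eval (coeff ?T j) x} * card B \<le> C j * c * card B ^ n"
    by (intro choice allI Suc.IH)
  then obtain C where C: "\<And>j p B c. prime p \<Longrightarrow> \<not> of_int (int p) dvd coeff ?T j \<Longrightarrow> finite B \<Longrightarrow>
           (\<forall>a. card {b\<in>B. [b = a] (mod int p)} \<le> c) \<Longrightarrow>
           card {x \<in> {1..n} \<rightarrow>\<^sub>E B. int p dvd mpoly_eval (coeff ?T j) x} * card B \<le> C j * c * card B ^ n"
    by (elim exE) (rule that, blast)
  define C' where "C' = degree ?T + (\<Sum>j\<le>degree ?T. C j)"
  have "card {x \<in> {1..Suc n} \<rightarrow>\<^sub>E B. int p dvd mpoly_eval R x} * card B \<le> C' * c * card B ^ Suc n"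
    if p: "prime p" "\<not> of_int (int p) dvd R" and B: "finite B"
      and c: "\<forall>a. card {b\<in>B. [b = a] (mod int p)} \<le> c" for p B c
  proof -
    have "\<exists>j. \<not> of_int (int p) dvd coeff ?T j"
    proof (rule ccontr)
      assume "\<not> ?thesis"
      then have "of_int (int p) dvd poly ?T (mvar (Suc n))"
        unfolding poly_altdef by (intro dvd_sum dvd_mult2) auto
      then show False using p(2) by (simp only: poly_mpoly_to_poly)
    qed
    then obtain j where j: "\<not> of_int (int p) dvd coeff ?T j" by blast
    then have "coeff ?T j \<noteq> 0" by auto
    then have jle: "j \<le> degree ?T" by (rule le_degree)
    let ?X = "{1..n} \<rightarrow>\<^sub>E B"
    have fX: "finite ?X" using B by (auto intro: finite_PiE)
    let ?N = "{x \<in> ?X. int p dvd mpoly_eval (coeff ?T j) x}"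
    have "card {x \<in> {1..Suc n} \<rightarrow>\<^sub>E B. int p dvd mpoly_eval R x} =
        (\<Sum>x\<in>?X. card {b\<in>B. int p dvd poly (specialize n R x) b})"
      by (simp only: card_PiE_Suc[OF B] poly_specialize[OF Suc.prems])
    also have "\<dots> \<le> (\<Sum>x\<in>?X. (if int p dvd mpoly_eval (coeff ?T j) x then card B else 0) + degree ?T * c)"
    proof (rule sum_mono)
      fix x assume "x \<in> ?X"
      show "card {b\<in>B. int p dvd poly (specialize n R x) b} \<le>
          (if int p dvd mpoly_eval (coeff ?T j) x then card B else 0) + degree ?T * c"
      proof (cases "int p dvd mpoly_eval (coeff ?T j) x")
        case True
        have "card {b\<in>B. int p dvd poly (specialize n R x) b} \<le> card B"
          using B by (intro card_mono) auto
        then show ?thesis using True by simp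
      next
        case False
        then have "\<exists>i. \<not> int p dvd coeff (specialize n R x) i" by (auto simp: coeff_specialize)
        then have "card {b\<in>B. int p dvd poly (specialize n R x) b} \<le> degree (specialize n R x) * c"
          using c by (intro card_roots_mod_prime p B) auto
        also have "\<dots> \<le> degree ?T * c" by (intro mult_right_mono degree_specialize) auto
        finally show ?thesis using False by simp
      qed
    qed
    also have "\<dots> = card ?N * card B + degree ?T * c * card B ^ n"
      using fX card_box[of n B] by (simp add: sum.distrib sum.If_cases Int_def conj_commute)
    finally have "card {x \<in> {1..Suc n} \<rightarrow>\<^sub>E B. int p dvd mpoly_eval R x} * card B \<le>
        (card ?N * card B + degree ?T * c * card B ^ n) * card B" by (rule mult_right_mono) simp
    also have "\<dots> \<le> (C j * c * card B ^ n + degree ?T * c * card B ^ n) * card B"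
      by (intro mult_right_mono add_right_mono C[OF p(1) j B c]) simp
    also have "\<dots> = (C j + degree ?T) * (c * card B ^ Suc n)" by (simp add: algebra_simps)
    also have "\<dots> \<le> C' * (c * card B ^ Suc n)"
      using jle by (intro mult_right_mono) (auto simp: C'_def intro: member_le_sum)
    finally show ?thesis by (simp add: mult.assoc)
  qed
  then show ?case by blast
qed

lemma card_residue_class_interval:
  assumes "p > 0"
  shows "card {b\<in>{- int k..int k}. [b = a] (mod int p)} \<le> 2 * k div p + 1"
proof -
  let ?S = "{b\<in>{- int k..int k}. [b = a] (mod int p)}"
  let ?f = "\<lambda>b. (b + int k) div int p"
  have "inj_on ?f ?S"
  proof (rule inj_onI)
    fix b b' assume b: "b \<in> ?S" "b' \<in> ?S" "?f b = ?f b'"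
    have "[b + int k = b' + int k] (mod int p)"
      using b by (intro cong_add cong_refl) (auto intro: cong_trans cong_sym)
    then have "b + int k = b' + int k"
      using b(3) by (metis cong_def mod_mult_div_eq)
    then show "b = b'" by simp
  qed
  moreover have "?f ` ?S \<subseteq> {0..int (2 * k div p)}"
  proof
    fix v assume "v \<in> ?f ` ?S"
    then obtain b where b: "b \<in> ?S" "v = ?f b" by blast
    have "?f b \<le> int (2 * k) div int p" using b assms by (intro zdiv_mono1) auto
    moreover have "0 \<le> ?f b" using b assms by (intro div_int_pos_iff[THEN iffD2]) auto
    ultimately show "v \<in> {0..int (2 * k div p)}" using b by (simp add: zdiv_int)
  qed
  ultimately have "card ?S \<le> card {0..int (2 * k div p)}" by (intro card_inj_on_le) auto
  then show ?thesis by simp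
qed

lemma mpoly_eval_poly_growth:
  assumes "P \<in> mpoly_ring n"
  shows "\<exists>L. \<forall>K x. 2 \<le> (K::nat) \<longrightarrow> (\<forall>i\<in>{1..n}. \<bar>x i\<bar> \<le> int K) \<longrightarrow> \<bar>mpoly_eval P x\<bar> \<le> int K ^ L"
proof -
  let ?G = "\<lambda>P. \<exists>L. \<forall>K x. 2 \<le> (K::nat) \<longrightarrow> (\<forall>i\<in>{1..n}. \<bar>x i\<bar> \<le> int K) \<longrightarrow> \<bar>mpoly_eval P x\<bar> \<le> int K ^ L"
  note h = ring_hom_mapD[OF ring_hom_mpoly_eval]
  have single: "?G (Poly_Mapping.single m c)" if m: "Poly_Mapping.keys m \<subseteq> {1..n}" for m c
  proof (intro exI allI impI)
    fix K :: nat and x assume K: "2 \<le> K" and x: "\<forall>i\<in>{1..n}. \<bar>x i\<bar> \<le> int K"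
    let ?e = "\<Sum>i\<in>Poly_Mapping.keys m. Poly_Mapping.lookup m i"
    have "\<bar>c\<bar> \<le> 2 ^ nat \<bar>c\<bar>" using of_nat_less_two_power[of "nat \<bar>c\<bar>", where ?'a = int] by simp
    also have "(2::int) ^ nat \<bar>c\<bar> \<le> int K ^ nat \<bar>c\<bar>" using K by (intro power_mono) auto
    finally have 1: "\<bar>c\<bar> \<le> int K ^ nat \<bar>c\<bar>" .
    have "\<bar>mono_eval x m\<bar> = (\<Prod>i\<in>Poly_Mapping.keys m. \<bar>x i\<bar> ^ Poly_Mapping.lookup m i)"
      by (simp add: mono_eval_def abs_prod power_abs)
    also have "\<dots> \<le> (\<Prod>i\<in>Poly_Mapping.keys m. int K ^ Poly_Mapping.lookup m i)"
      using x m by (intro prod_mono conjI power_mono) auto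
    also have "\<dots> = int K ^ ?e" by (simp add: power_sum)
    finally have "\<bar>c\<bar> * \<bar>mono_eval x m\<bar> \<le> int K ^ nat \<bar>c\<bar> * int K ^ ?e"
      using 1 by (intro mult_mono) auto
    then show "\<bar>mpoly_eval (Poly_Mapping.single m c) x\<bar> \<le> int K ^ (nat \<bar>c\<bar> + ?e)"
      by (simp add: mpoly_eval_conv_subst_eval subst_eval_single[OF ring_hom_id] abs_mult power_add)
  qed
  have add: "?G (P + Q)" if P: "?G P" and Q: "?G Q" for P Q
  proof -
    from P obtain L where L: "\<And>K x. 2 \<le> (K::nat) \<Longrightarrow> (\<forall>i\<in>{1..n}. \<bar>x i\<bar> \<le> int K) \<Longrightarrow> \<bar>mpoly_eval P x\<bar> \<le> int K ^ L"
      by blast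
    from Q obtain L' where L': "\<And>K x. 2 \<le> (K::nat) \<Longrightarrow> (\<forall>i\<in>{1..n}. \<bar>x i\<bar> \<le> int K) \<Longrightarrow> \<bar>mpoly_eval Q x\<bar> \<le> int K ^ L'"
      by blast
    show ?thesis
    proof (intro exI allI impI)
      fix K :: nat and x assume K: "2 \<le> K" and x: "\<forall>i\<in>{1..n}. \<bar>x i\<bar> \<le> int K"
      have "\<bar>mpoly_eval (P + Q) x\<bar> \<le> int K ^ L + int K ^ L'"
        using L[OF K x] L'[OF K x] by (simp add: h)
      also have "\<dots> \<le> int K ^ (L + L') + int K ^ (L + L')"
        using K by (intro add_mono power_increasing) auto
      also have "\<dots> \<le> int K * int K ^ (L + L')"
        using K mult_right_mono[of 2 "int K" "int K ^ (L + L')"] by simp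
      finally show "\<bar>mpoly_eval (P + Q) x\<bar> \<le> int K ^ Suc (L + L')" by simp
    qed
  qed
  have zero: "?G 0" by (simp add: h)
  have "?G (\<Sum>m\<in>S. Poly_Mapping.single m (Poly_Mapping.lookup P m))"
    if "finite S" "S \<subseteq> Poly_Mapping.keys P" for S
    using that
  proof induction
    case (insert m S)
    have "Poly_Mapping.keys m \<subseteq> {1..n}" using assms insert.prems unfolding mpoly_ring_def by blast
    from add[OF single[OF this] insert.IH] insert show ?case by (simp only: sum.insert insert_subset simp_thms)
  qed (use zero in simp)
  from this[of "Poly_Mapping.keys P"] show ?thesis
    by (simp only: mpoly_sum_monomials[of P, symmetric] finite_keys subset_refl simp_thms)
qed

text \<open>The product of the primes in \<open>S\<close> divides \<open>N\<close>, and it is at least $K^{|S|}$.\<close>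

lemma card_large_prime_divisors:
  assumes N: "N \<noteq> 0" "\<bar>N\<bar> \<le> int K ^ L" and K: "K \<ge> 2"
    and S: "\<And>p. p \<in> S \<Longrightarrow> prime p \<and> K < p \<and> int p dvd N" and fin: "finite S"
  shows "card S \<le> L"
proof -
  have "\<Prod>S dvd nat \<bar>N\<bar>" using fin S
  proof induction
    case (insert p S)
    have "coprime p (\<Prod>S)" using insert by (intro prod_coprime_right) (auto intro: primes_coprime)
    moreover have "p dvd nat \<bar>N\<bar>" using insert by (simp add: int_dvd_int_iff[symmetric])
    moreover have "\<Prod>S dvd nat \<bar>N\<bar>" using insert by blast
    ultimately have "p * \<Prod>S dvd nat \<bar>N\<bar>" by (intro divides_mult)
    then show ?case by (subst prod.insert[OF insert.hyps(1,2)])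
  qed simp
  then have "\<Prod>S \<le> nat \<bar>N\<bar>" using N by (intro dvd_imp_le) auto
  also have "nat \<bar>N\<bar> \<le> K ^ L" using N by (simp add: nat_le_iff)
  finally have "\<Prod>S \<le> K ^ L" .
  moreover have "K ^ card S \<le> \<Prod>S"
    using S prod_mono[of S "\<lambda>_. K" "\<lambda>p. p"] by (auto simp: less_imp_le)
  ultimately have "K ^ card S \<le> K ^ L" by linarith
  then show ?thesis using K power_le_imp_le_exp by auto
qed

lemma sum_inverse_squares_tail:
  assumes "M \<ge> 1" "M \<le> K"
  shows "(\<Sum>p\<in>{M<..K}. 1 / real p ^ 2) \<le> 1 / real M - 1 / real K"
  using assms(2)
proof (induction K rule: dec_induct)
  case (step K)
  have "{M<..Suc K} = insert (Suc K) {M<..K}" using step by auto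
  moreover have "1 / real (Suc K) ^ 2 \<le> 1 / real K - 1 / real (Suc K)"
  proof -
    have K: "real K > 0" using step assms(1) by simp
    then have "1 / (real K + 1) ^ 2 \<le> 1 / (real K * (real K + 1))"
      by (intro divide_left_mono) (auto simp: power2_eq_square)
    also have "\<dots> = 1 / real K - 1 / (real K + 1)" using K by (simp add: field_simps)
    finally show ?thesis by (simp add: add.commute)
  qed
  ultimately show ?case using step.IH by simp
qed simp

lemma ideal_gen_dvd_eval:
  assumes "R \<in> ideal_gen B U" "\<And>P. P \<in> U \<Longrightarrow> a dvd mpoly_eval P x"
  shows "a dvd mpoly_eval R (x :: nat \<Rightarrow> int)"
  using assms(1)
  by induction (auto simp: assms(2) ring_hom_mapD[OF ring_hom_mpoly_eval])

section \<open>Points whose values share a large prime factor\<close>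

definition large_prime_set :: "nat \<Rightarrow> int mpoly set \<Rightarrow> nat \<Rightarrow> nat \<Rightarrow> (nat \<Rightarrow> int) set" where
  "large_prime_set n U M k = {x \<in> {1..n} \<rightarrow>\<^sub>E {- int k..int k}.
     \<exists>p. prime p \<and> M < p \<and> (\<forall>P\<in>U. int p dvd mpoly_eval P x)}"

text \<open>The contribution of one line to the tail estimate. The base point \<open>x\<close> is such that no prime \<open>p > M\<close> divides
the values at \<open>x\<close> of all the coefficients, so each \<open>p\<close> leaves at most $D$ residue classes for the last coordinate, and
only prime divisors of the nonzero number $R(x)$ matter. Those exceeding the side $K$ of the box are at
most $L$ in number, and a residue class modulo such a prime has at most one point in the box.\<close>

lemma fibre_bound:
  fixes n k M :: nat and U :: "int mpoly set" and R :: "int mpoly"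
  defines "K \<equiv> 2 * k + 1" and "B \<equiv> {- int k..int k}"
    and "V \<equiv> \<Union>P\<in>U. range (coeff (mpoly_to_poly (Suc n) P))"
  assumes U: "U \<subseteq> mpoly_ring (Suc n)" and k: "k \<ge> 1"
    and D: "\<And>P. P \<in> U \<Longrightarrow> degree (mpoly_to_poly (Suc n) P) \<le> D"
    and R: "R \<in> mpoly_ring n" "R \<in> ideal_gen (mpoly_ring (Suc n)) U"
    and L: "\<bar>mpoly_eval R x\<bar> \<le> int K ^ L"
    and x: "x \<in> {1..n} \<rightarrow>\<^sub>E B" "x \<notin> large_prime_set n V M k" "mpoly_eval R x \<noteq> 0"
  shows "card {b\<in>B. \<exists>p. prime p \<and> M < p \<and> (\<forall>P\<in>U. int p dvd mpoly_eval P (x(Suc n := b)))} \<le>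
     (\<Sum>p | prime p \<and> p \<in> {M<..K} \<and> int p dvd mpoly_eval R x. D * (2 * k div p + 1)) + L * D"
proof -
  let ?r = "\<lambda>p. {b\<in>B. \<forall>P\<in>U. int p dvd mpoly_eval P (x(Suc n := b))}"
  let ?S = "{p. prime p \<and> M < p \<and> int p dvd mpoly_eval R x}"
  let ?S1 = "{p. prime p \<and> p \<in> {M<..K} \<and> int p dvd mpoly_eval R x}"
  let ?S2 = "{p. prime p \<and> M < p \<and> K < p \<and> int p dvd mpoly_eval R x}"
  have "finite {p. p dvd nat \<bar>mpoly_eval R x\<bar>}" using x(3) by (intro finite_divisors_nat) auto
  then have fS: "finite ?S" by (rule rev_finite_subset) (auto simp: int_dvd_int_iff[symmetric])
  have S12: "?S = ?S1 \<union> ?S2" "?S1 \<inter> ?S2 = {}" by (simp_all add: set_eq_iff) linarith+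
  have fin: "finite ?S1" "finite ?S2" using fS by (auto intro: rev_finite_subset)
  have c: "card (?r p) \<le> D * (2 * k div p + 1)" if p: "prime p" "M < p" for p
  proof -
    have "\<not> (\<forall>Q\<in>V. int p dvd mpoly_eval Q x)"
      using x p by (auto simp: large_prime_set_def B_def)
    then obtain P j where P: "P \<in> U" "\<not> int p dvd mpoly_eval (coeff (mpoly_to_poly (Suc n) P) j) x"
      by (auto simp: V_def)
    then have "\<exists>i. \<not> int p dvd coeff (specialize n P x) i" by (auto simp: coeff_specialize)
    then have "card {b\<in>B. int p dvd poly (specialize n P x) b} \<le> degree (specialize n P x) * (2 * k div p + 1)"
      unfolding B_def using prime_gt_0_nat[OF p(1)]
      by (intro card_roots_mod_prime p card_residue_class_interval) auto
    also have "\<dots> \<le> D * (2 * k div p + 1)"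
      using degree_specialize[of n P x] D[OF P(1)] by (intro mult_right_mono) auto
    finally have "card {b\<in>B. int p dvd poly (specialize n P x) b} \<le> D * (2 * k div p + 1)" .
    moreover have "card (?r p) \<le> card {b\<in>B. int p dvd poly (specialize n P x) b}"
    proof (rule card_mono)
      show "?r p \<subseteq> {b\<in>B. int p dvd poly (specialize n P x) b}"
        using P(1) by (auto simp: poly_specialize[OF subsetD[OF U P(1)]])
      show "finite {b\<in>B. int p dvd poly (specialize n P x) b}"
        by (rule finite_subset[of _ B]) (auto simp: B_def)
    qed
    ultimately show ?thesis by linarith
  qed
  have "{b\<in>B. \<exists>p. prime p \<and> M < p \<and> (\<forall>P\<in>U. int p dvd mpoly_eval P (x(Suc n := b)))} \<subseteq> (\<Union>p\<in>?S. ?r p)"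
  proof
    fix b assume "b \<in> {b\<in>B. \<exists>p. prime p \<and> M < p \<and> (\<forall>P\<in>U. int p dvd mpoly_eval P (x(Suc n := b)))}"
    then obtain p where b: "b \<in> B" "prime p" "M < p" "\<forall>P\<in>U. int p dvd mpoly_eval P (x(Suc n := b))"
      by blast
    have "int p dvd mpoly_eval R (x(Suc n := b))" using ideal_gen_dvd_eval[OF R(2)] b(4) by blast
    also have "mpoly_eval R (x(Suc n := b)) = mpoly_eval R x" by (rule mpoly_eval_cong[OF R(1)]) auto
    finally show "b \<in> (\<Union>p\<in>?S. ?r p)" using b by blast
  qed
  then have "card {b\<in>B. \<exists>p. prime p \<and> M < p \<and> (\<forall>P\<in>U. int p dvd mpoly_eval P (x(Suc n := b)))} \<le> card (\<Union>p\<in>?S. ?r p)"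
    
  proof (rule card_mono[rotated])
    have "finite (?r p)" for p by (rule finite_subset[of _ B]) (auto simp: B_def)
    then show "finite (\<Union>p\<in>?S. ?r p)" using fS by blast
  qed
  also have "\<dots> \<le> (\<Sum>p\<in>?S. card (?r p))" by (rule card_UN_le[OF fS])
  also have "\<dots> \<le> (\<Sum>p\<in>?S. D * (2 * k div p + 1))" by (intro sum_mono c) auto
  also have "\<dots> = (\<Sum>p\<in>?S1. D * (2 * k div p + 1)) + (\<Sum>p\<in>?S2. D * (2 * k div p + 1))"
    unfolding S12(1) by (rule sum.union_disjoint[OF fin S12(2)])
  also have "(\<Sum>p\<in>?S2. D * (2 * k div p + 1)) = (\<Sum>p\<in>?S2. D)"
    by (rule sum.cong) (auto simp: K_def)
  also have "\<dots> = card ?S2 * D" by simp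
  also have "\<dots> \<le> L * D"
    using k by (intro mult_right_mono card_large_prime_divisors[OF x(3) L] fin) (auto simp: K_def)
  finally show ?thesis by (simp only: add_le_cancel_left)
qed

text \<open>For $p \le K$ a residue class has at most $2K/p$ points in an interval with $K$ points. This enters once through the
Schwartz--Zippel bound for $R$ and once through the last coordinate, so that \<open>p\<close> contributes at most
$4 C D K^{n+1} / p^2$.\<close>

lemma middle_primes_bound:
  fixes n k M C D :: nat and R :: "int mpoly"
  defines "K \<equiv> 2 * k + 1" and "X \<equiv> {1..n} \<rightarrow>\<^sub>E {- int k..int k}"
  assumes C: "\<And>p B c. prime p \<Longrightarrow> \<not> of_int (int p) dvd R \<Longrightarrow> finite B \<Longrightarrow>
           (\<forall>a. card {b\<in>B. [b = a] (mod int p)} \<le> c) \<Longrightarrow>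
           card {x \<in> {1..n} \<rightarrow>\<^sub>E B. int p dvd mpoly_eval R x} * card B \<le> C * c * card B ^ n"
    and M: "\<And>p. prime p \<Longrightarrow> M < p \<Longrightarrow> \<not> of_int (int p) dvd R" "M \<ge> 1"
  shows "real (\<Sum>x\<in>X. \<Sum>p | prime p \<and> p \<in> {M<..K} \<and> int p dvd mpoly_eval R x. D * (2 * k div p + 1))
    \<le> 4 * real C * real D * real K ^ Suc n / real M"
proof -
  have K0: "K > 0" by (simp add: K_def)
  have fX: "finite X" unfolding X_def by (auto intro: finite_PiE)
  let ?T = "{p. prime p \<and> p \<in> {M<..K}}"
  have fT: "finite ?T" by (rule finite_subset[of _ "{M<..K}"]) auto
  have "(\<Sum>x\<in>X. \<Sum>p | prime p \<and> p \<in> {M<..K} \<and> int p dvd mpoly_eval R x. D * (2 * k div p + 1)) =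
     (\<Sum>x\<in>X. \<Sum>p\<in>?T. if int p dvd mpoly_eval R x then D * (2 * k div p + 1) else 0)"
    by (intro sum.cong refl sum.mono_neutral_cong_left fT) auto
  also have "\<dots> = (\<Sum>p\<in>?T. \<Sum>x\<in>X. if int p dvd mpoly_eval R x then D * (2 * k div p + 1) else 0)"
    by (rule sum.swap)
  also have "\<dots> = (\<Sum>p\<in>?T. card {x\<in>X. int p dvd mpoly_eval R x} * (D * (2 * k div p + 1)))"
    using fX by (simp add: sum.If_cases Int_def conj_commute)
  finally have "real (\<Sum>x\<in>X. \<Sum>p | prime p \<and> p \<in> {M<..K} \<and> int p dvd mpoly_eval R x. D * (2 * k div p + 1)) =
    (\<Sum>p\<in>?T. real (card {x\<in>X. int p dvd mpoly_eval R x}) * (real D * real (2 * k div p + 1)))"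
    by (simp only: of_nat_sum of_nat_mult)
  also have "\<dots> \<le> (\<Sum>p\<in>?T. 4 * real C * real D * real K ^ Suc n * (1 / real p ^ 2))"
  proof (rule sum_mono)
    fix p assume p: "p \<in> ?T"
    then have p0: "real p > 0" by auto
    let ?c = "2 * k div p + 1"
    have "card {x\<in>X. int p dvd mpoly_eval R x} * card {- int k..int k} \<le> C * ?c * card {- int k..int k} ^ n"
      unfolding X_def using p M card_residue_class_interval[of p k] by (intro C) auto
    moreover have cB: "card {- int k..int k} = K" by (simp add: K_def)
    ultimately have N: "card {x\<in>X. int p dvd mpoly_eval R x} * K \<le> C * ?c * K ^ n" by simp
    have "real ?c * real p \<le> real (2 * k) + real p"
    proof -
      have "?c * p \<le> 2 * k + p" by (simp add: algebra_simps)
      then show ?thesis by (metis of_nat_add of_nat_le_iff of_nat_mult)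
    qed
    also have "\<dots> \<le> 2 * real K" using p by (auto simp: K_def)
    finally have cc: "real ?c \<le> 2 * real K / real p" using p0 by (simp add: field_simps)
    have "real (card {x\<in>X. int p dvd mpoly_eval R x}) * (real D * real ?c) * real K
        = real (card {x\<in>X. int p dvd mpoly_eval R x} * K) * (real D * real ?c)" by simp
    also have "\<dots> \<le> real (C * ?c * K ^ n) * (real D * real ?c)"
      by (intro mult_right_mono of_nat_mono N) auto
    also have "\<dots> = real C * real D * real K ^ n * (real ?c * real ?c)"
      by (simp only: of_nat_mult of_nat_power mult_ac)
    also have "\<dots> \<le> real C * real D * real K ^ n * ((2 * real K / real p) * (2 * real K / real p))"
      by (intro mult_left_mono mult_mono cc) auto
    also have "\<dots> = 4 * real C * real D * real K ^ Suc n * (1 / real p ^ 2) * real K"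
      by (simp add: power2_eq_square field_simps)
    finally show "real (card {x\<in>X. int p dvd mpoly_eval R x}) * (real D * real ?c)
        \<le> 4 * real C * real D * real K ^ Suc n * (1 / real p ^ 2)"
      by (rule mult_right_le_imp_le) (use K0 in simp)
  qed
  also have "\<dots> = 4 * real C * real D * real K ^ Suc n * (\<Sum>p\<in>?T. 1 / real p ^ 2)"
    by (simp only: sum_distrib_left)
  also have "\<dots> \<le> 4 * real C * real D * real K ^ Suc n * (1 / real M)"
  proof (rule mult_left_mono)
    have "(\<Sum>p\<in>?T. 1 / real p ^ 2) \<le> (\<Sum>p\<in>{M<..K}. 1 / real p ^ 2)"
      by (intro sum_mono2) auto
    also have "\<dots> \<le> 1 / real M"
    proof (cases "M \<le> K")
      case True
      have "(\<Sum>p\<in>{M<..K}. 1 / real p ^ 2) \<le> 1 / real M - 1 / real K"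
        by (rule sum_inverse_squares_tail[OF M(2) True])
      also have "\<dots> \<le> 1 / real M" by simp
      finally show ?thesis .
    qed simp
    finally show "(\<Sum>p\<in>?T. 1 / real p ^ 2) \<le> 1 / real M" .
  qed simp
  finally show ?thesis by simp
qed

text \<open>The tail estimate, by induction on the number of variables. The points \<open>x\<close> of the base fall into three groups:
those at which a prime \<open>p > M1\<close> divides the values of all the coefficients with respect to the last variable, which
are few by induction; the zeros of the eliminant $R$, which have density $O(1/K)$; and the others, whose
lines are covered by the two preceding lemmas.\<close>

lemma large_prime_set_small:
  assumes "finite U" "U \<subseteq> mpoly_ring n" "coprime_family n U" "\<epsilon> > 0"
  shows "\<exists>M k0. \<forall>k\<ge>k0. real (card (large_prime_set n U M k)) \<le> \<epsilon> * real (2 * k + 1) ^ n"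
  using assms
proof (induction n arbitrary: U \<epsilon>)
  case 0
  obtain P where P: "P \<in> U" "P \<noteq> 0" using coprime_family_nonzero[OF 0(3)] by blast
  let ?c = "Poly_Mapping.lookup P 0"
  have Pc: "P = Poly_Mapping.single 0 ?c" using mpoly_ring_0 P 0 by blast
  then have c0: "?c \<noteq> 0" using P by (metis single_zero)
  have ev: "mpoly_eval P x = ?c" for x using P(1) 0(2) by (intro mpoly_eval_ring_0) blast
  have "large_prime_set 0 U (nat \<bar>?c\<bar>) k = {}" for k
  proof -
    have False if "prime p" "nat \<bar>?c\<bar> < p" "int p dvd ?c" for p
      using dvd_imp_le_int[OF c0 that(3)] that(2) by simp
    then show ?thesis using P(1) ev by (fastforce simp: large_prime_set_def)
  qed
  then show ?case using 0 by (intro exI[of _ "nat \<bar>?c\<bar>"] exI[of _ 0]) simp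
next
  case (Suc n)
  let ?T = "mpoly_to_poly (Suc n)"
  define V where "V = (\<Union>P\<in>U. range (coeff (?T P)))"
  have "finite (range (coeff f))" for f :: "int mpoly poly"
    by (rule finite_subset[of _ "insert 0 (coeff f ` {..degree f})"])
      (auto simp: image_iff coeff_eq_0 intro: le_degree)
  then have "finite V" using Suc.prems by (simp add: V_def)
  moreover have "V \<subseteq> mpoly_ring n"
    using Suc.prems polys_overD[OF mpoly_to_poly_in_polys_over] by (auto simp: V_def)
  moreover have "coprime_family n V" unfolding V_def by (rule coprime_family_coeffs) fact
  ultimately obtain M1 k1 where
    IH: "\<And>k. k \<ge> k1 \<Longrightarrow> real (card (large_prime_set n V M1 k)) \<le> \<epsilon> / 2 * real (2 * k + 1) ^ n"
    using Suc.IH[of V "\<epsilon> / 2"] \<open>\<epsilon> > 0\<close> by auto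
  obtain R where R: "R \<in> mpoly_ring n" "R \<noteq> 0" "R \<in> ideal_gen (mpoly_ring (Suc n)) U"
    using elimination[OF Suc.prems(1-3)] by blast
  obtain C where C: "\<And>p B c. prime p \<Longrightarrow> \<not> of_int (int p) dvd R \<Longrightarrow> finite B \<Longrightarrow>
           (\<forall>a. card {b\<in>B. [b = a] (mod int p)} \<le> c) \<Longrightarrow>
           card {x \<in> {1..n} \<rightarrow>\<^sub>E B. int p dvd mpoly_eval R x} * card B \<le> C * c * card B ^ n"
    using schwartz_zippel_mod_prime[OF R(1)] by (elim exE) (rule that, blast)
  obtain L where L: "\<And>K x. 2 \<le> (K::nat) \<Longrightarrow> (\<forall>i\<in>{1..n}. \<bar>x i\<bar> \<le> int K) \<Longrightarrow> \<bar>mpoly_eval R x\<bar> \<le> int K ^ L"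
    using mpoly_eval_poly_growth[OF R(1)] by (elim exE) (rule that, blast)
  define D where "D = (\<Sum>P\<in>U. degree (?T P))"
  have D: "degree (?T P) \<le> D" if "P \<in> U" for P
    unfolding D_def using that Suc.prems by (intro member_le_sum) auto
  obtain m where m: "Poly_Mapping.lookup R m \<noteq> 0"
    using R(2) by (metis lookup_zero poly_mapping_eqI)
  define M2 where "M2 = nat \<bar>Poly_Mapping.lookup R m\<bar>"
  have M2: "\<not> of_int (int p) dvd R" if "M2 < p" for p :: nat
  proof
    assume "of_int (int p) dvd R"
    then have "int p dvd Poly_Mapping.lookup R m" by (rule of_int_dvd_imp_dvd_lookup)
    then show False using dvd_imp_le_int[OF m] that by (fastforce simp: M2_def)
  qed
  \<comment> \<open>Beyond \<open>M2\<close> no prime divides \<open>R\<close>. The last entry makes the bound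
     \<open>4 * C * D / M\<close> for the primes up to \<open>K\<close> at most \<open>\<epsilon> / 4\<close>.\<close>
  define M where "M = max (max M1 M2) (max 1 (nat \<lceil>16 * real C * real D / \<epsilon>\<rceil>))"
  \<comment> \<open>From \<open>k0\<close> on, the terms of order \<open>K ^ n\<close> are at most \<open>\<epsilon> / 4 * K ^ Suc n\<close>.\<close>
  define k0 where "k0 = max (max k1 1) (nat \<lceil>4 * real (C + L * D) / \<epsilon>\<rceil>)"
  have M: "M \<ge> M1" "M \<ge> M2" "M \<ge> 1" "nat \<lceil>16 * real C * real D / \<epsilon>\<rceil> \<le> M"
    by (simp_all only: M_def le_max_iff_disj order_refl simp_thms)
  have M_large: "16 * real C * real D / \<epsilon> \<le> real M"
    using real_nat_ceiling_ge M(4) of_nat_mono order.trans by blast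
  have "real (card (large_prime_set (Suc n) U M k)) \<le> \<epsilon> * real (2 * k + 1) ^ Suc n" if k: "k \<ge> k0" for k
  proof -
    have "k0 \<ge> k1" "k0 \<ge> 1" "nat \<lceil>4 * real (C + L * D) / \<epsilon>\<rceil> \<le> k0"
      by (simp_all only: k0_def le_max_iff_disj order_refl simp_thms)
    then have "k \<ge> k1" "k \<ge> 1" "nat \<lceil>4 * real (C + L * D) / \<epsilon>\<rceil> \<le> k"
      using k order.trans by blast+
    moreover from this(3) have "4 * real (C + L * D) / \<epsilon> \<le> real k"
      using real_nat_ceiling_ge of_nat_mono order.trans by blast
    ultimately have k': "k \<ge> k1" "k \<ge> 1" "4 * real (C + L * D) / \<epsilon> \<le> real k" by blast+
    define K where "K = 2 * k + 1"
    let ?B = "{- int k..int k}"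
    let ?X = "{1..n} \<rightarrow>\<^sub>E ?B"
    have fX: "finite ?X" by (auto intro: finite_PiE)
    have cB: "card ?B = K" by (simp add: K_def)
    have cX: "card ?X = K ^ n" by (simp only: card_box cB)
    let ?W = "\<lambda>x. card {b\<in>?B. \<exists>p. prime p \<and> M < p \<and> (\<forall>P\<in>U. int p dvd mpoly_eval P (x(Suc n := b)))}"
    let ?mid = "\<lambda>x. \<Sum>p | prime p \<and> p \<in> {M<..K} \<and> int p dvd mpoly_eval R x. D * (2 * k div p + 1)"
    let ?bad = "large_prime_set n V M1 k"
    let ?Z = "{x\<in>?X. mpoly_eval R x = 0}"
    have "card (large_prime_set (Suc n) U M k) = (\<Sum>x\<in>?X. ?W x)"
      unfolding large_prime_set_def by (rule card_PiE_Suc) simp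
    also have "\<dots> \<le> (\<Sum>x\<in>?X. (if x \<in> ?bad then K else 0) + (if mpoly_eval R x = 0 then K else 0) + (?mid x + L * D))"
    proof (rule sum_mono)
      fix x assume x: "x \<in> ?X"
      show "?W x \<le> (if x \<in> ?bad then K else 0) + (if mpoly_eval R x = 0 then K else 0) + (?mid x + L * D)"
      proof (cases "x \<in> ?bad \<or> mpoly_eval R x = 0")
        case True
        have "?W x \<le> card ?B" by (intro card_mono) auto
        then show ?thesis using True cB by auto
      next
        case False
        have "\<bar>x i\<bar> \<le> int K" if "i \<in> {1..n}" for i
          using PiE_mem[OF x that] by (auto simp: K_def)
        then have Lx: "\<bar>mpoly_eval R x\<bar> \<le> int (2 * k + 1) ^ L"
          using L[of K x] k' by (auto simp: K_def)
        have "x \<notin> large_prime_set n V M k"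
          using False M(1) by (auto simp: large_prime_set_def)
        then have "?W x \<le> ?mid x + L * D"
          unfolding K_def V_def
          using fibre_bound[OF Suc.prems(2) k'(2) D R(1,3) Lx x] False by blast
        then show ?thesis by simp
      qed
    qed
    also have "\<dots> = card ?bad * K + card ?Z * K + (\<Sum>x\<in>?X. ?mid x) + L * D * K ^ n"
    proof -
      have "?X \<inter> ?bad = ?bad" by (auto simp: large_prime_set_def)
      then have "(\<Sum>x\<in>?X. if x \<in> ?bad then K else 0) = card ?bad * K"
        using fX by (simp add: sum.If_cases)
      moreover have "(\<Sum>x\<in>?X. if mpoly_eval R x = 0 then K else 0) = card ?Z * K"
        using fX by (simp add: sum.If_cases Int_def)
      ultimately show ?thesis using cX by (simp add: sum.distrib)
    qed
    finally have "real (card (large_prime_set (Suc n) U M k)) \<le>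
        real (card ?bad * K) + real (card ?Z * K) + real (\<Sum>x\<in>?X. ?mid x) + real (L * D * K ^ n)"
      by (simp only: of_nat_add[symmetric] of_nat_le_iff)
    moreover have "real (card ?bad * K) \<le> \<epsilon> / 2 * real K ^ Suc n"
    proof -
      have "real (card ?bad * K) = real (card ?bad) * real K" by (rule of_nat_mult)
      also have "\<dots> \<le> \<epsilon> / 2 * real K ^ n * real K"
        using IH[OF k'(1)] unfolding K_def by (rule mult_right_mono) simp
      finally show ?thesis by (simp only: power_Suc mult_ac)
    qed
    moreover have "card ?Z * K \<le> C * K ^ n"
    proof -
      \<comment> \<open>A zero of \<open>R\<close> is a zero modulo every prime. Modulo a prime that exceeds the side of the
         box, every residue class has at most one point, so that the Schwartz--Zippel bound is sharpest.\<close>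
      obtain q where q: "prime q" "q > max K M2" using bigger_prime by blast
      have "card {x \<in> ?X. int q dvd mpoly_eval R x} * card ?B \<le> C * 1 * card ?B ^ n"
        using q M2 card_residue_class_interval[of q k] by (intro C) (auto simp: K_def)
      moreover have "card ?Z \<le> card {x \<in> ?X. int q dvd mpoly_eval R x}"
        using fX by (intro card_mono) auto
      ultimately have "card ?Z * K \<le> C * 1 * K ^ n"
        unfolding cB using mult_le_mono1 order.trans by blast
      then show ?thesis by simp
    qed
    then have "real (card ?Z * K) \<le> real (C * K ^ n)" by (rule of_nat_mono)
    then have "real (card ?Z * K) \<le> real C * real K ^ n" by (simp only: of_nat_mult[of C] of_nat_power)
    moreover have "real (\<Sum>x\<in>?X. ?mid x) \<le> \<epsilon> / 4 * real K ^ Suc n"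
    proof -
      have "real (\<Sum>x\<in>?X. ?mid x) \<le> 4 * real C * real D * real K ^ Suc n / real M"
        unfolding K_def using M2 M by (intro middle_primes_bound C) auto
      also have "\<dots> = 4 * real C * real D / real M * real K ^ Suc n" by simp
      also have "\<dots> \<le> \<epsilon> / 4 * real K ^ Suc n"
      proof (rule mult_right_mono)
        show "4 * real C * real D / real M \<le> \<epsilon> / 4"
          using M(3) M_large \<open>\<epsilon> > 0\<close> by (simp add: field_simps)
      qed simp
      finally show ?thesis .
    qed
    moreover have "real C * real K ^ n + real (L * D * K ^ n) \<le> \<epsilon> / 4 * real K ^ Suc n"
    proof -
      have "real C * real K ^ n + real (L * D * K ^ n) = real (C + L * D) * real K ^ n"
        by (simp add: algebra_simps)
      also have "\<dots> \<le> (\<epsilon> / 4 * real K) * real K ^ n"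
      proof (rule mult_right_mono)
        have "4 * real (C + L * D) \<le> \<epsilon> * real k" using k'(3) \<open>\<epsilon> > 0\<close> by (simp add: field_simps)
        also have "\<dots> \<le> \<epsilon> * real K" using \<open>\<epsilon> > 0\<close> by (simp add: K_def)
        finally show "real (C + L * D) \<le> \<epsilon> / 4 * real K" by simp
      qed simp
      finally show ?thesis by simp
    qed
    ultimately have "real (card (large_prime_set (Suc n) U M k)) \<le>
        \<epsilon> / 2 * real K ^ Suc n + \<epsilon> / 4 * real K ^ Suc n + \<epsilon> / 4 * real K ^ Suc n" by linarith
    then show ?thesis by (simp add: K_def algebra_simps)
  qed
  then show ?case by blast
qed

section \<open>Densities of periodic sets\<close>

definition periodic :: "nat \<Rightarrow> nat \<Rightarrow> ((nat \<Rightarrow> int) \<Rightarrow> bool) \<Rightarrow> bool" where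
  "periodic d N S \<longleftrightarrow> (\<forall>x y. (\<forall>i\<in>{1..d}. [x i = y i] (mod int N)) \<longrightarrow> S x = S y)"

definition residue_density :: "nat \<Rightarrow> nat \<Rightarrow> ((nat \<Rightarrow> int) \<Rightarrow> bool) \<Rightarrow> real" where
  "residue_density d N S = real (card {x \<in> {1..d} \<rightarrow>\<^sub>E {0..<int N}. S x}) / real N ^ d"

lemma card_by_fibres:
  assumes "finite S" "finite T" "g ` S \<subseteq> T"
  shows "card S = (\<Sum>y\<in>T. card {x\<in>S. g x = y})"
  using sum.group[OF assms, of "\<lambda>_. 1 :: nat"] by simp

text \<open>The upper bound for one class is elementary. The lower bound follows from it, because the
counts of all $N$ classes add up to the length of the interval.\<close>

lemma residue_class_discrepancy:
  assumes "N > 0"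
  shows "\<bar>real (card {b\<in>{- int k..int k}. [b = a] (mod int N)}) - real (2 * k + 1) / real N\<bar> \<le> real N"
proof -
  let ?B = "{- int k..int k}"
  let ?c = "\<lambda>a. card {b\<in>?B. [b = a] (mod int N)}"
  have upper: "real (?c a) \<le> real (2 * k + 1) / real N + 1" for a
  proof -
    have "real (?c a) \<le> real (2 * k div N) + 1"
      using card_residue_class_interval[OF assms, of k a] by linarith
    also have "real (2 * k div N) \<le> real (2 * k) / real N"
    proof -
      have "real (2 * k div N) * real N \<le> real (2 * k)"
        by (simp only: of_nat_mult[symmetric] of_nat_le_iff div_times_less_eq_dividend)
      then show ?thesis using assms by (simp add: pos_le_divide_eq)
    qed
    also have "\<dots> \<le> real (2 * k + 1) / real N" by (intro divide_right_mono) auto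
    finally show ?thesis by simp
  qed
  define a0 where "a0 = a mod int N"
  have a0: "a0 \<in> {0..<int N}" using assms by (simp add: a0_def)
  have ca: "?c a = ?c a0" by (simp add: a0_def cong_def)
  have "card ?B = (\<Sum>y\<in>{0..<int N}. card {b\<in>?B. b mod int N = y})"
    by (rule card_by_fibres) (use assms in auto)
  also have "\<dots> = (\<Sum>y\<in>{0..<int N}. ?c y)"
    by (intro sum.cong refl arg_cong[of _ _ card]) (auto simp: cong_def)
  also have "\<dots> = ?c a0 + (\<Sum>y\<in>{0..<int N} - {a0}. ?c y)"
    using a0 by (intro sum.remove) auto
  finally have "real (2 * k + 1) = real (?c a0) + (\<Sum>y\<in>{0..<int N} - {a0}. real (?c y))"
    by (simp flip: of_nat_sum of_nat_add)
  also have "(\<Sum>y\<in>{0..<int N} - {a0}. real (?c y)) \<le>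
      (\<Sum>y\<in>{0..<int N} - {a0}. real (2 * k + 1) / real N + 1)"
    by (intro sum_mono upper)
  also have "\<dots> = (real N - 1) * (real (2 * k + 1) / real N + 1)"
    using a0 assms by (simp add: of_nat_diff)
  also have "\<dots> = real (2 * k + 1) - real (2 * k + 1) / real N + real N - 1"
    using assms by (simp add: field_simps)
  finally have "real (2 * k + 1) / real N - real N \<le> real (?c a)" unfolding ca by linarith
  moreover have "real N \<ge> 1" using assms by simp
  ultimately show ?thesis using upper[of a] by linarith
qed

lemma interval_residue_density:
  assumes "N > 0"
  shows "(\<lambda>k. real (card {b\<in>{- int k..int k}. [b = a] (mod int N)}) / real (2 * k + 1)) \<longlonglongrightarrow> 1 / real N"
proof (rule LIM_zero_cancel, rule Lim_null_comparison)
  let ?c = "\<lambda>k. real (card {b\<in>{- int k..int k}. [b = a] (mod int N)})"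
  show "\<forall>\<^sub>F k in sequentially. norm (?c k / real (2 * k + 1) - 1 / real N) \<le> real N / real (2 * k + 1)"
  proof (rule always_eventually, rule allI)
    fix k
    have "norm (?c k / real (2 * k + 1) - 1 / real N) =
        \<bar>(?c k - real (2 * k + 1) / real N) / real (2 * k + 1)\<bar>"
      by (simp add: diff_divide_distrib del: of_nat_add of_nat_Suc)
    also have "\<dots> = \<bar>?c k - real (2 * k + 1) / real N\<bar> / real (2 * k + 1)"
      by (simp only: abs_divide abs_of_nat)
    also have "\<dots> \<le> real N / real (2 * k + 1)"
      by (intro divide_right_mono residue_class_discrepancy assms) simp
    finally show "norm (?c k / real (2 * k + 1) - 1 / real N) \<le> real N / real (2 * k + 1)" .
  qed
  have "strict_mono (\<lambda>k::nat. 2 * k + 1)" by (rule strict_monoI) simp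
  from LIMSEQ_subseq_LIMSEQ[OF lim_const_over_n[of "real N"] this]
  show "(\<lambda>k. real N / real (2 * k + 1)) \<longlonglongrightarrow> 0" by (simp add: o_def)
qed

lemma reduce_in_residue_box:
  assumes "N > 0"
  shows "(\<lambda>i\<in>{1..d::nat}. x i mod int N) \<in> {1..d} \<rightarrow>\<^sub>E {0..<int N}"
  using assms by auto

text \<open>A periodic set is a disjoint union of products of residue classes, and each of these products has density $N^{-d}$.\<close>

lemma box_density_periodic:
  assumes N: "N > 0" and S: "periodic d N S"
  shows "(\<lambda>k. real (card {x \<in> {1..d} \<rightarrow>\<^sub>E {- int k..int k}. S x}) / real (2 * k + 1) ^ d)
           \<longlonglongrightarrow> residue_density d N S"
proof -
  let ?B = "\<lambda>k::nat. {- int k..int k}"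
  let ?c = "\<lambda>k a. card {b\<in>?B k. [b = a] (mod int N)}"
  let ?R = "{a \<in> {1..d} \<rightarrow>\<^sub>E {0..<int N}. S a}"
  let ?red = "\<lambda>x. \<lambda>i\<in>{1..d}. x i mod int N"
  have fR: "finite ?R" by (auto intro!: finite_PiE finite_subset[OF Collect_subset])
  have Sred: "S (?red x) \<longleftrightarrow> S x" for x
    using S unfolding periodic_def by (auto simp: cong_def)
  have count: "card {x \<in> {1..d} \<rightarrow>\<^sub>E ?B k. S x} = (\<Sum>a\<in>?R. \<Prod>i\<in>{1..d}. ?c k (a i))" for k
  proof -
    have "card {x \<in> {1..d} \<rightarrow>\<^sub>E ?B k. S x} =
        (\<Sum>a\<in>?R. card {x \<in> {x \<in> {1..d} \<rightarrow>\<^sub>E ?B k. S x}. ?red x = a})"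
    proof (rule card_by_fibres[OF _ fR])
      show "finite {x \<in> {1..d} \<rightarrow>\<^sub>E ?B k. S x}"
        by (auto intro!: finite_PiE finite_subset[OF Collect_subset])
      show "?red ` {x \<in> {1..d} \<rightarrow>\<^sub>E ?B k. S x} \<subseteq> ?R"
        using Sred reduce_in_residue_box[OF N] by blast
    qed
    also have "\<dots> = (\<Sum>a\<in>?R. card (\<Pi>\<^sub>E i\<in>{1..d}. {b\<in>?B k. [b = a i] (mod int N)}))"
    proof (intro sum.cong refl arg_cong[of _ _ card])
      fix a assume a: "a \<in> ?R"
      have am: "a i mod int N = a i" if "i \<in> {1..d}" for i
        using a that by (auto dest!: PiE_mem)
      show "{x \<in> {x \<in> {1..d} \<rightarrow>\<^sub>E ?B k. S x}. ?red x = a} = (\<Pi>\<^sub>E i\<in>{1..d}. {b\<in>?B k. [b = a i] (mod int N)})"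
      proof (intro equalityI subsetI)
        fix x assume x: "x \<in> {x \<in> {x \<in> {1..d} \<rightarrow>\<^sub>E ?B k. S x}. ?red x = a}"
        then have "?red x i = a i" for i by blast
        then have "x i mod int N = a i" if "i \<in> {1..d}" for i using that by (metis restrict_apply')
        then show "x \<in> (\<Pi>\<^sub>E i\<in>{1..d}. {b\<in>?B k. [b = a i] (mod int N)})"
          using x am by (auto simp: cong_def PiE_iff)
      next
        fix x assume x: "x \<in> (\<Pi>\<^sub>E i\<in>{1..d}. {b\<in>?B k. [b = a i] (mod int N)})"
        then have xB: "x \<in> {1..d} \<rightarrow>\<^sub>E ?B k" by (auto simp: PiE_iff)
        have "?red x = a"
        proof (rule extensionalityI[of _ "{1..d}"])
          show "a \<in> extensional {1..d}" using a by (auto simp: PiE_iff)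
          fix i assume i: "i \<in> {1..d}"
          have "[x i = a i] (mod int N)" using PiE_mem[OF x i] by blast
          then show "?red x i = a i" using i am by (simp add: cong_def)
        qed simp
        moreover from this have "S x" using a Sred[of x] by simp
        ultimately show "x \<in> {x \<in> {x \<in> {1..d} \<rightarrow>\<^sub>E ?B k. S x}. ?red x = a}" using xB by blast
      qed
    qed
    also have "\<dots> = (\<Sum>a\<in>?R. \<Prod>i\<in>{1..d}. ?c k (a i))" by (simp add: card_PiE)
    finally show ?thesis .
  qed
  have "(\<lambda>k. \<Sum>a\<in>?R. \<Prod>i\<in>{1..d}. real (?c k (a i)) / real (2 * k + 1)) \<longlonglongrightarrow> (\<Sum>a\<in>?R. \<Prod>i\<in>{1..d}. 1 / real N)"
    by (intro tendsto_sum tendsto_prod interval_residue_density[OF N])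
  also have "(\<lambda>k. \<Sum>a\<in>?R. \<Prod>i\<in>{1..d}. real (?c k (a i)) / real (2 * k + 1)) =
      (\<lambda>k. real (card {x \<in> {1..d} \<rightarrow>\<^sub>E ?B k. S x}) / real (2 * k + 1) ^ d)"
    by (rule ext) (simp only: count of_nat_sum of_nat_prod prod_dividef prod_constant card_atLeastAtMost
        diff_Suc_1' diff_add_inverse Suc_eq_plus1 add_diff_cancel_right' sum_divide_distrib)
  also have "(\<Sum>a\<in>?R. \<Prod>i\<in>{1..d}. 1 / real N) = residue_density d N S"
    by (simp add: residue_density_def power_divide)
  finally show ?thesis .
qed

text \<open>The Chinese remainder theorem in every coordinate: reduction modulo both moduli is a bijection
from the solutions modulo $NM$ onto the pairs of solutions.\<close>

lemma residue_density_mult: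
  assumes N: "N > 0" "M > 0" "coprime N M" and S: "periodic d N S" and T: "periodic d M T"
  shows "residue_density d (N * M) (\<lambda>x. S x \<and> T x) = residue_density d N S * residue_density d M T"
proof -
  let ?X = "{x \<in> {1..d} \<rightarrow>\<^sub>E {0..<int (N * M)}. S x \<and> T x}"
  let ?red = "\<lambda>N x. \<lambda>i\<in>{1..d}. x i mod int N"
  let ?XS = "{x \<in> {1..d} \<rightarrow>\<^sub>E {0..<int N}. S x}" and ?XT = "{x \<in> {1..d} \<rightarrow>\<^sub>E {0..<int M}. T x}"
  let ?g = "\<lambda>x. (?red N x, ?red M x)"
  have cop: "coprime (int N) (int M)" using N(3) by simp
  have Sred: "S (?red N x) \<longleftrightarrow> S x" for x
    using S unfolding periodic_def by (auto simp: cong_def)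
  have Tred: "T (?red M x) \<longleftrightarrow> T x" for x
    using T unfolding periodic_def by (auto simp: cong_def)
  have inj: "inj_on ?g ?X"
  proof (rule inj_onI)
    fix x y assume x: "x \<in> ?X" and y: "y \<in> ?X" and eq: "?g x = ?g y"
    show "x = y"
    proof (rule extensionalityI[of _ "{1..d}"])
      show "x \<in> extensional {1..d}" "y \<in> extensional {1..d}" using x y by (auto simp: PiE_iff)
      fix i assume i: "i \<in> {1..d}"
      have "?red N x i = ?red N y i" "?red M x i = ?red M y i" using eq by (metis prod.inject)+
      then have "[x i = y i] (mod int N)" "[x i = y i] (mod int M)" using i by (simp_all add: cong_def)
      then have "[x i = y i] (mod int (N * M))" using cop by (simp add: coprime_cong_mult)
      moreover have "x i \<in> {0..<int (N * M)}" "y i \<in> {0..<int (N * M)}" using x y i by (auto dest: PiE_mem)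
      ultimately show "x i = y i" 
        using cong_less_imp_eq_int[of "x i" "int (N * M)" "y i"] by auto
    qed
  qed
  have image: "?g ` ?X = ?XS \<times> ?XT"
  proof (intro equalityI subsetI)
    fix z assume "z \<in> ?g ` ?X"
    then obtain x where x: "x \<in> ?X" "z = ?g x" by blast
    have "S x" "T x" using x(1) by auto
    then have "S (?red N x)" "T (?red M x)" by (simp_all only: Sred Tred)
    then show "z \<in> ?XS \<times> ?XT"
      unfolding x(2) by (intro SigmaI CollectI conjI reduce_in_residue_box N)
  next
    fix z assume "z \<in> ?XS \<times> ?XT"
    then obtain a b where z: "z = (a, b)" and a: "a \<in> ?XS" and b: "b \<in> ?XT" by blast
    have "\<exists>v. [v = a i] (mod int N) \<and> [v = b i] (mod int M)" for i
      by (rule binary_chinese_remainder_int[OF cop])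
    then obtain v where v: "[v i = a i] (mod int N)" "[v i = b i] (mod int M)" for i by metis
    define x where "x = ?red (N * M) v"
    have xv: "[x i = v i] (mod int N)" "[x i = v i] (mod int M)" if "i \<in> {1..d}" for i
      using that by (simp_all add: x_def cong_def mod_mod_cancel)
    have rN: "?red N x = a"
    proof (rule extensionalityI[of _ "{1..d}"])
      show "a \<in> extensional {1..d}" using a by (auto simp: PiE_iff)
      fix i assume i: "i \<in> {1..d}"
      have "a i \<in> {0..<int N}" using a i by (auto dest: PiE_mem)
      then show "?red N x i = a i" using i xv(1)[OF i] v(1)[of i] by (simp add: cong_def)
    qed simp
    have rM: "?red M x = b"
    proof (rule extensionalityI[of _ "{1..d}"])
      show "b \<in> extensional {1..d}" using b by (auto simp: PiE_iff)
      fix i assume i: "i \<in> {1..d}"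
      have "b i \<in> {0..<int M}" using b i by (auto dest: PiE_mem)
      then show "?red M x i = b i" using i xv(2)[OF i] v(2)[of i] by (simp add: cong_def)
    qed simp
    have "S x" "T x" using a b rN rM Sred[of x] Tred[of x] by simp_all
    moreover have "x \<in> {1..d} \<rightarrow>\<^sub>E {0..<int (N * M)}"
      unfolding x_def using N by (intro reduce_in_residue_box) simp
    ultimately have "x \<in> ?X" by blast
    moreover have "z = ?g x" using z rN rM by simp
    ultimately show "z \<in> ?g ` ?X" by blast
  qed
  have "card ?X = card (?XS \<times> ?XT)" unfolding image[symmetric] by (rule card_image[OF inj, symmetric])
  then have "card ?X = card ?XS * card ?XT" by (simp only: card_cartesian_product)
  then show ?thesis by (simp add: residue_density_def power_mult_distrib)
qed

lemma periodic_mult: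
  assumes "periodic d N S" "N dvd M"
  shows "periodic d M S"
  unfolding periodic_def
proof (intro allI impI)
  fix x y :: "nat \<Rightarrow> int" assume "\<forall>i\<in>{1..d}. [x i = y i] (mod int M)"
  then have "\<forall>i\<in>{1..d}. [x i = y i] (mod int N)"
    using assms(2) by (meson cong_dvd_modulus int_dvd_int_iff)
  then show "S x = S y" using assms(1) by (auto simp: periodic_def)
qed

lemma residue_density_prod:
  fixes q :: "nat \<Rightarrow> nat"
  assumes "\<And>j. j \<in> {1..n} \<Longrightarrow> q j > 0" "\<And>j. j \<in> {1..n} \<Longrightarrow> periodic d (q j) (S j)"
    and "\<And>i j. i \<in> {1..n} \<Longrightarrow> j \<in> {1..n} \<Longrightarrow> i \<noteq> j \<Longrightarrow> coprime (q i) (q j)"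
  shows "periodic d (\<Prod>j=1..n. q j) (\<lambda>x. \<forall>j\<in>{1..n}. S j x) \<and>
    residue_density d (\<Prod>j=1..n. q j) (\<lambda>x. \<forall>j\<in>{1..n}. S j x) = (\<Prod>j=1..n. residue_density d (q j) (S j))"
  using assms
proof (induction n)
  case 0
  have "card ({1..d} \<rightarrow>\<^sub>E {0..<(1::int)}) = 1" by (simp only: card_box) simp
  then show ?case by (simp add: periodic_def residue_density_def)
next
  case (Suc n)
  let ?q = "\<Prod>j=1..n. q j" and ?S = "\<lambda>x. \<forall>j\<in>{1..n}. S j x"
  have IH: "periodic d ?q ?S" "residue_density d ?q ?S = (\<Prod>j=1..n. residue_density d (q j) (S j))"
    using Suc.IH Suc.prems by auto
  have e: "(\<lambda>x. \<forall>j\<in>{1..Suc n}. S j x) = (\<lambda>x. ?S x \<and> S (Suc n) x)"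
    by (auto simp: fun_eq_iff atLeastAtMostSuc_conv)
  have p: "(\<Prod>j=1..Suc n. q j) = ?q * q (Suc n)" by simp
  have "coprime ?q (q (Suc n))" using Suc.prems(3) by (intro prod_coprime_left) auto
  moreover have "?q > 0" using Suc.prems(1) by (intro prod_pos) auto
  moreover have "periodic d (q (Suc n)) (S (Suc n))" "q (Suc n) > 0" using Suc.prems(1,2) by auto
  ultimately have "residue_density d (?q * q (Suc n)) (\<lambda>x. ?S x \<and> S (Suc n) x) =
      residue_density d ?q ?S * residue_density d (q (Suc n)) (S (Suc n))"
    by (intro residue_density_mult IH(1)) auto
  moreover have "periodic d (?q * q (Suc n)) (\<lambda>x. ?S x \<and> S (Suc n) x)"
    using periodic_mult[OF IH(1), of "?q * q (Suc n)"]
      periodic_mult[OF \<open>periodic d (q (Suc n)) (S (Suc n))\<close>, of "?q * q (Suc n)"]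
    by (simp add: periodic_def)
  ultimately show ?case unfolding e p IH(2) by simp
qed

section \<open>The local conditions\<close>

text \<open>Two residues modulo a prime power are associated iff they have the same greatest common divisor with the
modulus. For the harder direction divide by that divisor $g$: the quotients are invertible modulo
$q' = p^e / g$, and their ratio is coprime to \<open>p\<close> provided that $q' \ne 1$. If $q' = 1$, both residues are
zero and $u = 1$ works.\<close>

lemma mult_unit_cong_iff_gcd_eq:
  fixes a b :: int and p e :: nat
  assumes p: "prime p"
  shows "(\<exists>u. coprime u (int (p ^ e)) \<and> [a = u * b] (mod int (p ^ e))) \<longleftrightarrow>
           gcd a (int (p ^ e)) = gcd b (int (p ^ e))"
proof
  assume "\<exists>u. coprime u (int (p ^ e)) \<and> [a = u * b] (mod int (p ^ e))"
  then obtain u where u: "coprime u (int (p ^ e))" "[a = u * b] (mod int (p ^ e))" by blast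
  show "gcd a (int (p ^ e)) = gcd b (int (p ^ e))"
    using cong_gcd_eq[OF u(2)] gcd_mult_left_left_cancel[OF coprime_commute[THEN iffD1, OF u(1)], of b]
    by (metis gcd.commute)
next
  let ?q = "int (p ^ e)"
  assume eq: "gcd a ?q = gcd b ?q"
  define g where "g = gcd a ?q"
  have q0: "?q \<noteq> 0" using p by (simp add: prime_gt_0_nat)
  then have g0: "g \<noteq> 0" by (simp add: g_def)
  obtain a' q' where a': "a = g * a'" "?q = g * q'" "coprime a' q'"
    unfolding g_def using gcd_coprime_exists[of a ?q] g0 by (metis g_def mult.commute)
  obtain b' q'' where b': "b = g * b'" "?q = g * q''" "coprime b' q''"
    unfolding g_def eq using gcd_coprime_exists[of b ?q] g0 by (metis eq g_def mult.commute)
  have "q'' = q'" using a' b' g0 by simp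
  show "\<exists>u. coprime u ?q \<and> [a = u * b] (mod ?q)"
  proof (cases "is_unit q'")
    case True
    then have "?q dvd a" "?q dvd b"
      unfolding a'(2) a'(1) b'(1) by (auto intro!: mult_dvd_mono unit_imp_dvd simp del: zdvd1_eq)
    then have "[a = 1 * b] (mod ?q)" by (metis cong_0_iff cong_sym cong_trans mult_1)
    then show ?thesis by (intro exI[of _ 1]) simp
  next
    case False
    obtain c where c: "[b' * c = 1] (mod q')"
      using b'(3) \<open>q'' = q'\<close> cong_solve_coprime_int by blast
    have "coprime c q'"
      using c by (metis cong_imp_coprime cong_sym coprime_1_left coprime_mult_left_iff)
    then have "coprime (a' * c) q'" using a'(3) by simp
    moreover have "int p dvd q'"
    proof (rule ccontr)
      assume "\<not> int p dvd q'"
      moreover have "prime (int p)" using p by simp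
      ultimately have "coprime (int p) q'" by (intro prime_imp_coprime)
      then have "coprime q' (int p)" by (simp only: coprime_commute)
      then have "coprime q' ?q" by simp
      moreover have "q' dvd ?q" using a'(2) by simp
      ultimately show False using False by (metis coprime_common_divisor dvd_refl)
    qed
    ultimately have "coprime (a' * c) (int p)" by (meson coprime_divisors dvd_refl)
    then have "coprime (a' * c) ?q" by simp
    moreover have "[a = (a' * c) * b] (mod ?q)"
    proof -
      have "q' dvd b' * c - 1" using c by (simp add: cong_iff_dvd_diff)
      then obtain k where k: "b' * c - 1 = q' * k" by blast
      have "(a' * c) * b - a = g * a' * (b' * c - 1)" using a'(1) b'(1) by (simp add: algebra_simps)
      also have "\<dots> = ?q * (a' * k)" unfolding k a'(2) by (simp add: algebra_simps)
      finally show ?thesis by (metis cong_iff_dvd_diff cong_sym dvd_triv_left)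
    qed
    ultimately show ?thesis by blast
  qed
qed

lemma mpoly_eval_mod_cong:
  fixes P :: "int mpoly"
  assumes "P \<in> mpoly_ring d" "\<And>i. i \<in> {1..d} \<Longrightarrow> [x i = y i] (mod N)"
  shows "[mpoly_eval P x = mpoly_eval P y] (mod N)"
  unfolding mpoly_eval_def
proof (intro cong_sum cong_mult cong_refl cong_prod cong_pow)
  fix m i assume "m \<in> Poly_Mapping.keys P" "i \<in> Poly_Mapping.keys m"
  then show "[x i = y i] (mod N)" using mpoly_ringD[OF assms(1)] assms(2) by auto
qed

lemma gcd_Gcd_eval_cong:
  fixes V :: "int mpoly set" and N :: int
  assumes V: "V \<subseteq> mpoly_ring d" and xy: "\<And>i. i \<in> {1..d} \<Longrightarrow> [x i = y i] (mod N)"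
  shows "gcd (Gcd ((\<lambda>P. mpoly_eval P x) ` V)) N = gcd (Gcd ((\<lambda>P. mpoly_eval P y) ` V)) N"
proof -
  have *: "gcd (Gcd ((\<lambda>P. mpoly_eval P x) ` V)) N dvd gcd (Gcd ((\<lambda>P. mpoly_eval P y) ` V)) N"
    if xy: "\<And>i. i \<in> {1..d} \<Longrightarrow> [x i = y i] (mod N)" for x y
  proof (intro gcd_greatest gcd_dvd2 Gcd_greatest)
    let ?g = "gcd (Gcd ((\<lambda>P. mpoly_eval P x) ` V)) N"
    fix v assume "v \<in> (\<lambda>P. mpoly_eval P y) ` V"
    then obtain P where P: "P \<in> V" "v = mpoly_eval P y" by blast
    have "[mpoly_eval P x = mpoly_eval P y] (mod N)" using V P xy by (intro mpoly_eval_mod_cong) auto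
    then have "[mpoly_eval P x = v] (mod ?g)" unfolding P(2) by (rule cong_dvd_modulus) simp
    moreover have "Gcd ((\<lambda>P. mpoly_eval P x) ` V) dvd mpoly_eval P x" using P(1) by (intro Gcd_dvd) auto
    then have "?g dvd mpoly_eval P x" using dvd_trans[OF gcd_dvd1] by blast
    ultimately show "?g dvd v" using cong_dvd_iff by blast
  qed
  show ?thesis
    using *[OF xy] *[OF cong_sym[OF xy]] by (intro zdvd_antisym_nonneg) auto
qed

lemma prime_nth_prime: "prime (nth_prime j)"
  unfolding nth_prime_def using enumerate_in_set[OF primes_infinite] by blast

lemma nth_prime_less: "1 \<le> i \<Longrightarrow> i < j \<Longrightarrow> nth_prime i < nth_prime j"
  unfolding nth_prime_def by (rule enumerate_mono[OF _ primes_infinite]) auto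

lemma nth_prime_inj: "1 \<le> i \<Longrightarrow> 1 \<le> j \<Longrightarrow> nth_prime i = nth_prime j \<Longrightarrow> i = j"
  using nth_prime_less by (metis less_irrefl linorder_neqE_nat)

lemma nth_prime_ge: "j - 1 \<le> nth_prime j"
  unfolding nth_prime_def by (rule le_enumerate[OF primes_infinite])

lemma prime_eq_nth_prime:
  assumes "prime p"
  shows "\<exists>j\<ge>1. p = nth_prime j"
proof -
  obtain n where "enumerate {p. prime p} n = p" using enumerate_Ex[OF primes_infinite] assms by blast
  then show ?thesis by (intro exI[of _ "Suc n"]) (simp add: nth_prime_def)
qed

text \<open>This is why the modulus at the \<open>j\<close>-th prime has the exponent \<open>s j + 1\<close>: it is large enough to detect the
exact power of that prime in every $y_i$.\<close>

lemma nth_prime_power_not_dvd: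
  fixes s :: "nat \<Rightarrow> nat"
  assumes fin: "finite {j. j \<ge> 1 \<and> s j \<noteq> 0}" and j: "j \<ge> 1"
  shows "\<not> nth_prime j ^ (s j + 1) dvd (\<Prod>j | j \<ge> 1 \<and> s j \<noteq> 0. nth_prime j ^ s j)"
proof
  let ?J = "{j. j \<ge> 1 \<and> s j \<noteq> 0}"
  let ?r = "\<Prod>i\<in>?J - {j}. nth_prime i ^ s i"
  have p: "prime (nth_prime j)" by (rule prime_nth_prime)
  have "(\<Prod>j\<in>?J. nth_prime j ^ s j) = nth_prime j ^ s j * ?r"
  proof (cases "j \<in> ?J")
    case True
    then show ?thesis using fin by (rule prod.remove[rotated])
  next
    case False
    then show ?thesis using j by simp
  qed
  moreover assume "nth_prime j ^ (s j + 1) dvd (\<Prod>j\<in>?J. nth_prime j ^ s j)"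
  ultimately have "nth_prime j dvd ?r" using p by (simp add: prime_gt_0_nat)
  then obtain i where i: "i \<in> ?J - {j}" "nth_prime j dvd nth_prime i ^ s i"
    using fin p by (auto simp: prime_dvd_prod_iff)
  then have "nth_prime j dvd nth_prime i" using p prime_dvd_power by blast
  then have "nth_prime j = nth_prime i" using p prime_nth_prime primes_dvd_imp_eq by blast
  then show False using nth_prime_inj i j by blast
qed

text \<open>Equality of the greatest common divisors with \<open>q\<close> expresses equality of the coordinates modulo \<open>q\<close> up to units.
Only the coordinates $i \le r$ occur, since the others can be matched by a positive integer whatever
their residue is.\<close>

definition local_condition :: "nat \<Rightarrow> (nat \<Rightarrow> int mpoly set) \<Rightarrow> nat \<Rightarrow> (nat \<Rightarrow> nat) \<Rightarrow> nat \<Rightarrow> (nat \<Rightarrow> int) \<Rightarrow> bool" where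
  "local_condition w U r y q x \<longleftrightarrow> (\<forall>i\<in>{1..r}. gcd (gcd_vec w U x i) (int q) = gcd (int (y i)) (int q))"

lemma periodic_local_condition:
  assumes "r \<le> w" "\<And>i. i \<in> {1..w} \<Longrightarrow> U i \<subseteq> mpoly_ring d"
  shows "periodic d q (local_condition w U r y q)"
  unfolding periodic_def
proof (intro allI impI)
  fix x x' :: "nat \<Rightarrow> int" assume xx': "\<forall>i\<in>{1..d}. [x i = x' i] (mod int q)"
  have "gcd (gcd_vec w U x i) (int q) = gcd (gcd_vec w U x' i) (int q)" if "i \<in> {1..r}" for i
    using gcd_Gcd_eval_cong[of "U i" d x x' "int q"] xx' assms that by (simp add: gcd_vec_def)
  then show "local_condition w U r y q x = local_condition w U r y q x'"
    by (simp add: local_condition_def)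
qed

lemma local_prob_eq_residue_density:
  assumes Z: "Z = {z \<in> {1..w} \<rightarrow>\<^sub>E {0<..}. \<forall>i\<in>{1..r}. z i = int (y i)}"
    and y: "\<And>i. i \<in> {1..r} \<Longrightarrow> y i > 0" and p: "prime p" and rw: "r \<le> w"
  shows "local_prob d w U p e Z = residue_density d (p ^ e) (local_condition w U r y (p ^ e))"
proof -
  let ?q = "int (p ^ e)"
  have q0: "?q > 0" using p by (simp add: prime_gt_0_nat)
  have iff: "(\<exists>z\<in>Z. \<forall>i\<in>{1..w}. \<exists>u. coprime u ?q \<and> [gcd_vec w U x i = u * z i] (mod ?q)) \<longleftrightarrow>
      local_condition w U r y (p ^ e) x" for x
    unfolding mult_unit_cong_iff_gcd_eq[OF p]
  proof
    assume "\<exists>z\<in>Z. \<forall>i\<in>{1..w}. gcd (gcd_vec w U x i) ?q = gcd (z i) ?q"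
    then obtain z where z: "z \<in> Z" "\<forall>i\<in>{1..w}. gcd (gcd_vec w U x i) ?q = gcd (z i) ?q" by blast
    have "gcd (gcd_vec w U x i) ?q = gcd (int (y i)) ?q" if "i \<in> {1..r}" for i
    proof -
      have "z i = int (y i)" using z(1) that by (simp add: Z)
      moreover have "i \<in> {1..w}" using that rw by simp
      ultimately show ?thesis using z(2) by metis
    qed
    then show "local_condition w U r y (p ^ e) x" by (simp add: local_condition_def)
  next
    assume loc: "local_condition w U r y (p ^ e) x"
    \<comment> \<open>A vanishing coordinate beyond \<open>r\<close> is represented by the positive multiple \<open>?q\<close> of the modulus.\<close>
    define z where "z = (\<lambda>i\<in>{1..w}. if i \<in> {1..r} then int (y i)
      else if gcd_vec w U x i = 0 then ?q else gcd_vec w U x i)"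
    have "gcd_vec w U x i \<ge> 0" if "i \<in> {1..w}" for i using that by (simp add: gcd_vec_def)
    then have "z i > 0" if "i \<in> {1..w}" for i
      using that y q0 by (auto simp: z_def order.order_iff_strict)
    then have "z \<in> Z" using rw by (auto simp: Z z_def)
    moreover have "gcd (gcd_vec w U x i) ?q = gcd (z i) ?q" if "i \<in> {1..w}" for i
      using loc that by (auto simp: z_def local_condition_def)
    ultimately show "\<exists>z\<in>Z. \<forall>i\<in>{1..w}. gcd (gcd_vec w U x i) ?q = gcd (z i) ?q" by blast
  qed
  let ?X = "{1..d} \<rightarrow>\<^sub>E {0..<?q}"
  have fin: "finite ?X" by (auto intro: finite_PiE)
  have ne: "?X \<noteq> {}" using q0 by (auto simp: PiE_eq_empty_iff)
  have "card ?X = (p ^ e) ^ d" by (simp only: card_box card_atLeastLessThan_int diff_zero nat_int)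
  then show ?thesis
    unfolding local_prob_def iff residue_density_def measure_pmf_of_set[OF ne fin]
    by (simp only: Int_def mem_Collect_eq of_nat_power)
qed

lemma box_prob_eq:
  "box_prob d w U k Z = real (card {x \<in> {1..d} \<rightarrow>\<^sub>E {- int k..int k}. gcd_vec w U x \<in> Z}) / real (2 * k + 1) ^ d"
proof -
  let ?X = "{1..d} \<rightarrow>\<^sub>E {- int k..int k}"
  have fin: "finite ?X" by (auto intro: finite_PiE)
  have ne: "?X \<noteq> {}" by (auto simp: PiE_eq_empty_iff)
  have "card {- int k..int k} = 2 * k + 1" by simp
  then have "card ?X = (2 * k + 1) ^ d" by (simp only: card_box)
  then show ?thesis
    unfolding box_prob_def measure_pmf_of_set[OF ne fin]
    by (simp only: Int_def mem_Collect_eq of_nat_power)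
qed

lemma large_prime_set_antimono:
  assumes "M \<le> N"
  shows "large_prime_set n U N k \<subseteq> large_prime_set n U M k"
proof
  fix x assume "x \<in> large_prime_set n U N k"
  then obtain p where p: "x \<in> {1..n} \<rightarrow>\<^sub>E {- int k..int k}" "prime p" "N < p" "\<forall>P\<in>U. int p dvd mpoly_eval P x"
    unfolding large_prime_set_def by blast
  moreover have "M < p" using assms p(3) by simp
  ultimately show "x \<in> large_prime_set n U M k" unfolding large_prime_set_def by blast
qed

text \<open>The conditions at the first \<open>n\<close> primes fix the valuations there, as \<open>y\<close> has a smaller valuation than the
modulus. At the remaining primes both numbers have valuation $0$. The hypothesis \<open>M < n\<close> is used for the fact
that the \<open>j\<close>-th prime exceeds \<open>M\<close> when \<open>j > n\<close>.\<close>

lemma eq_from_local_conditions: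
  fixes g :: int and Y y n M :: nat and s :: "nat \<Rightarrow> nat"
  assumes g: "g > 0" and y: "y > 0"
    and Y: "\<And>j. j \<ge> 1 \<Longrightarrow> \<not> nth_prime j ^ (s j + 1) dvd y"
    and n: "\<And>j. j > n \<Longrightarrow> s j = 0" "\<And>p. prime p \<Longrightarrow> M < p \<Longrightarrow> \<not> int p dvd g" "M < n"
    and loc: "\<And>j. j \<in> {1..n} \<Longrightarrow> gcd g (int (nth_prime j ^ (s j + 1))) = gcd (int y) (int (nth_prime j ^ (s j + 1)))"
  shows "g = int y"
proof (rule multiplicity_eq_int)
  fix p :: int assume p: "prime p"
  define pn where "pn = nat p"
  have "p = int pn" using prime_gt_0_int[OF p] by (simp add: pn_def)
  moreover from this have "prime pn" using p by simp
  ultimately have pn: "p = int pn" "prime pn" by blast+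
  then obtain j where j: "j \<ge> 1" "pn = nth_prime j" using prime_eq_nth_prime by blast
  let ?t = "s j + 1"
  have ny: "\<not> p ^ ?t dvd int y"
    using Y[OF j(1)] unfolding pn(1) j(2) by (metis int_dvd_int_iff of_nat_power)
  have both: "p ^ e dvd g \<longleftrightarrow> p ^ e dvd int y" if "e \<le> ?t" for e
  proof (cases "j \<le> n")
    case True
    then have eq: "gcd g (p ^ ?t) = gcd (int y) (p ^ ?t)" using loc[of j] j pn by simp
    have "p ^ e dvd p ^ ?t" using that by (rule le_imp_power_dvd)
    then have "p ^ e dvd a \<longleftrightarrow> p ^ e dvd gcd a (p ^ ?t)" for a by simp
    then show ?thesis using eq by metis
  next
    case False
    then have "j - 1 > M" using n(3) by simp
    then have "pn > M" using nth_prime_ge[of j] j by simp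
    then have ng: "\<not> p dvd g" using n(2) pn by blast
    have "s j = 0" using n(1) False by simp
    then have "\<not> p dvd int y" "e = 0 \<or> e = 1" using ny that by auto
    then show ?thesis using ng by auto
  qed
  have ng: "\<not> p ^ ?t dvd g" using both[of ?t] ny by blast
  have "p ^ e dvd g \<longleftrightarrow> p ^ e dvd int y" for e
  proof (cases "e \<le> ?t")
    case False
    then have "p ^ ?t dvd p ^ e" by (intro le_imp_power_dvd) simp
    then show ?thesis using ng ny dvd_trans by blast
  qed (rule both)
  then show "multiplicity p g = multiplicity p (int y)" by (simp add: multiplicity_def)
qed (use g y in auto)

section \<open>The density as an infinite product\<close>

theorem theorem2p8:
  fixes d h w r Y :: nat
    and F :: "nat \<Rightarrow> int mpoly" and U :: "nat \<Rightarrow> int mpoly set"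
    and y s :: "nat \<Rightarrow> nat" and Z :: "(nat \<Rightarrow> int) set"
  assumes "d \<ge> 1" and "h \<ge> 1" and "w \<ge> 1"
    and "\<And>i. i \<in> {1..h} \<Longrightarrow> F i \<in> mpoly_ring d"
    and "\<And>i. i \<in> {1..h} \<Longrightarrow> F i \<noteq> 0"
    and "\<And>i. i \<in> {1..w} \<Longrightarrow> U i \<noteq> {} \<and> U i \<subseteq> F ` {1..h}"
    and "is_mpoly_gcd d (rat_mpoly ` F ` {1..h}) 1"
    and "\<And>i. i \<in> {1..w} \<Longrightarrow> is_mpoly_gcd d (rat_mpoly ` U i) 1"
    and "1 \<le> r" and "r \<le> w"
    and "\<And>i. i \<in> {1..r} \<Longrightarrow> y i > 0"
    and "finite {j. j \<ge> 1 \<and> s j \<noteq> 0}"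
    and "Y = (\<Prod>j | j \<ge> 1 \<and> s j \<noteq> 0. nth_prime j ^ s j)"
    and "\<And>i. i \<in> {1..r} \<Longrightarrow> y i dvd Y"
    and "Z = {z \<in> {1..w} \<rightarrow>\<^sub>E {0<..}. \<forall>i\<in>{1..r}. z i = int (y i)}"
  shows "density_exists d w U Z \<and>
    (\<lambda>n. \<Prod>j=1..n. local_prob d w U (nth_prime j) (s j + 1) Z) \<longlonglongrightarrow> gcd_density d w U Z"
proof -
  note w = assms(3) and F = assms(4) and U = assms(6) and cop = assms(8) and rw = assms(10)
    and y = assms(11) and fin = assms(12) and Y = assms(13) and yY = assms(14) and Z = assms(15)
  define q where "q j = nth_prime j ^ (s j + 1)" for j
  define a where "a k = box_prob d w U k Z" for k
  \<comment> \<open>The points that satisfy the local conditions at the first \<open>n\<close> primes.\<close>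
  define A where "A n x \<longleftrightarrow> (\<forall>j\<in>{1..n}. local_condition w U r y (q j) x)" for n x
  define b where "b n k = real (card {x \<in> {1..d} \<rightarrow>\<^sub>E {- int k..int k}. A n x}) / real (2 * k + 1) ^ d" for n k
  define c where "c n = (\<Prod>j=1..n. local_prob d w U (nth_prime j) (s j + 1) Z)" for n
  have Ud: "U i \<subseteq> mpoly_ring d" if "i \<in> {1..w}" for i using U[OF that] F by auto
  have Ufin: "finite (U i)" if "i \<in> {1..w}" for i using U[OF that] by (auto intro: finite_subset)
  have Ucop: "coprime_family d (U i)" if "i \<in> {1..w}" for i
    using cop[OF that] by (auto simp: coprime_family_def is_mpoly_gcd_def)
  have q0: "q j > 0" for j using prime_nth_prime[of j] by (simp add: q_def prime_gt_0_nat)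
  have dens: "b n \<longlonglongrightarrow> c n" for n
  proof -
    have per: "periodic d (\<Prod>j=1..n. q j) (\<lambda>x. \<forall>j\<in>{1..n}. local_condition w U r y (q j) x) \<and>
      residue_density d (\<Prod>j=1..n. q j) (\<lambda>x. \<forall>j\<in>{1..n}. local_condition w U r y (q j) x) =
        (\<Prod>j=1..n. residue_density d (q j) (local_condition w U r y (q j)))"
    proof (rule residue_density_prod)
      show "periodic d (q j) (local_condition w U r y (q j))" for j
        using rw Ud by (intro periodic_local_condition) auto
      fix i j assume ij: "i \<in> {1..n}" "j \<in> {1..n}" "i \<noteq> j"
      then have "nth_prime i \<noteq> nth_prime j" using nth_prime_inj by auto
      then have "coprime (nth_prime i) (nth_prime j)" using prime_nth_prime by (intro primes_coprime)
      then show "coprime (q i) (q j)" by (simp add: q_def)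
    qed (rule q0)
    have "(\<Prod>j=1..n. residue_density d (q j) (local_condition w U r y (q j))) = c n"
      unfolding c_def q_def
      using local_prob_eq_residue_density[OF Z y prime_nth_prime rw] by (intro prod.cong) auto
    moreover have "(\<Prod>j=1..n. q j) > 0" using q0 by (intro prod_pos) auto
    ultimately show ?thesis
      using box_density_periodic[of "\<Prod>j=1..n. q j" d "\<lambda>x. \<forall>j\<in>{1..n}. local_condition w U r y (q j) x"] per
      unfolding b_def[abs_def] A_def by simp
  qed
  have lp: "0 \<le> local_prob d w U p e Z" "local_prob d w U p e Z \<le> 1" for p e
    by (simp_all add: local_prob_def)
  have c0: "0 \<le> c n" for n unfolding c_def by (intro prod_nonneg) (simp add: lp)
  have "c (Suc n) \<le> c n" for n
    using mult_left_mono[OF lp(2) c0[of n]] by (simp add: c_def)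
  then have "decseq c" by (intro decseq_SucI)
  then obtain l where l: "c \<longlonglongrightarrow> l" using decseq_convergent[of c 0] c0 by blast
  have upper: "a k \<le> b n k" for n k
  proof -
    have "{x \<in> {1..d} \<rightarrow>\<^sub>E {- int k..int k}. gcd_vec w U x \<in> Z} \<subseteq> {x \<in> {1..d} \<rightarrow>\<^sub>E {- int k..int k}. A n x}"
      by (auto simp: A_def local_condition_def Z)
    then have "card {x \<in> {1..d} \<rightarrow>\<^sub>E {- int k..int k}. gcd_vec w U x \<in> Z} \<le>
        card {x \<in> {1..d} \<rightarrow>\<^sub>E {- int k..int k}. A n x}"
      by (intro card_mono) (auto intro!: finite_PiE finite_subset[OF Collect_subset])
    then show ?thesis unfolding a_def b_def box_prob_eq by (intro divide_right_mono) auto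
  qed
  have in_Z: "gcd_vec w U x \<in> Z"
    if x: "x \<in> {1..d} \<rightarrow>\<^sub>E {- int k..int k}" "A n x" 
      and nl: "\<forall>i\<in>{1..w}. x \<notin> large_prime_set d (U i) M k"
      and n: "M < n" "\<And>j. j > n \<Longrightarrow> s j = 0" for x n M k
  proof -
    have large: "\<not> int p dvd gcd_vec w U x i" if i: "i \<in> {1..w}" and p: "prime p" "M < p" for i p
    proof
      assume "int p dvd gcd_vec w U x i"
      then have "\<forall>P\<in>U i. int p dvd mpoly_eval P x" using i by (simp add: gcd_vec_def dvd_Gcd_iff)
      then have "x \<in> large_prime_set d (U i) M k" using x(1) p by (auto simp: large_prime_set_def)
      then show False using nl i by blast
    qed
    have pos: "gcd_vec w U x i > 0" if i: "i \<in> {1..w}" for i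
    proof -
      \<comment> \<open>If the greatest common divisor were zero, every large prime would divide it.\<close>
      obtain p where "prime p" "M < p" using bigger_prime by blast
      then have "gcd_vec w U x i \<noteq> 0" using large[OF i] by fastforce
      moreover have "gcd_vec w U x i \<ge> 0" using i by (simp add: gcd_vec_def)
      ultimately show ?thesis by simp
    qed
    have "gcd_vec w U x i = int (y i)" if i: "i \<in> {1..r}" for i
    proof (rule eq_from_local_conditions[where M = M and n = n and s = s])
      have iw: "i \<in> {1..w}" using i rw by simp
      show "gcd_vec w U x i > 0" by (rule pos[OF iw])
      show "y i > 0" by (rule y[OF i])
      show "\<not> nth_prime j ^ (s j + 1) dvd y i" if "j \<ge> 1" for j
        using nth_prime_power_not_dvd[OF fin that] yY[OF i] unfolding Y by (meson dvd_trans)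
      show "\<not> int p dvd gcd_vec w U x i" if "prime p" "M < p" for p using large[OF iw that] .
      show "gcd (gcd_vec w U x i) (int (nth_prime j ^ (s j + 1))) = gcd (int (y i)) (int (nth_prime j ^ (s j + 1)))"
        if "j \<in> {1..n}" for j
        using x(2) that i unfolding A_def local_condition_def q_def by blast
    qed (use n in auto)
    moreover have "gcd_vec w U x \<in> {1..w} \<rightarrow>\<^sub>E {0<..}"
      using pos by (auto simp: gcd_vec_def PiE_iff)
    ultimately show ?thesis by (simp add: Z)
  qed
  have "a \<longlonglongrightarrow> l"
  proof (rule LIMSEQ_I)
    fix \<epsilon> :: real assume \<epsilon>: "\<epsilon> > 0"
    define \<delta> where "\<delta> = \<epsilon> / 4 / real w"
    have \<delta>: "\<delta> > 0" using \<epsilon> w by (simp add: \<delta>_def)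
    have "\<forall>i\<in>{1..w}. \<exists>Mk. \<forall>k\<ge>snd Mk. real (card (large_prime_set d (U i) (fst Mk) k)) \<le> \<delta> * real (2 * k + 1) ^ d"
    proof
      fix i assume i: "i \<in> {1..w}"
      obtain M k0 where "\<forall>k\<ge>k0. real (card (large_prime_set d (U i) M k)) \<le> \<delta> * real (2 * k + 1) ^ d"
        using large_prime_set_small[OF Ufin[OF i] Ud[OF i] Ucop[OF i] \<delta>] by blast
      then show "\<exists>Mk. \<forall>k\<ge>snd Mk. real (card (large_prime_set d (U i) (fst Mk) k)) \<le> \<delta> * real (2 * k + 1) ^ d"
        by (intro exI[of _ "(M, k0)"]) simp
    qed
    then obtain Mk where Mk: "\<And>i k. i \<in> {1..w} \<Longrightarrow> k \<ge> snd (Mk i) \<Longrightarrow>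
        real (card (large_prime_set d (U i) (fst (Mk i)) k)) \<le> \<delta> * real (2 * k + 1) ^ d"
      by (rule bchoice[THEN exE]) blast
    define M where "M = (\<Sum>i\<in>{1..w}. fst (Mk i))"
    define k1 where "k1 = (\<Sum>i\<in>{1..w}. snd (Mk i))"
    have large: "real (card (large_prime_set d (U i) M k)) \<le> \<delta> * real (2 * k + 1) ^ d"
      if i: "i \<in> {1..w}" and k: "k \<ge> k1" for i k
    proof -
      have "fst (Mk i) \<le> M" "snd (Mk i) \<le> k1"
        unfolding M_def k1_def using i by (auto intro: member_le_sum)
      then have "large_prime_set d (U i) M k \<subseteq> large_prime_set d (U i) (fst (Mk i)) k"
        by (intro large_prime_set_antimono)
      moreover have "finite (large_prime_set d (U i) (fst (Mk i)) k)"
        unfolding large_prime_set_def by (auto intro!: finite_PiE finite_subset[OF Collect_subset])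
      ultimately have "card (large_prime_set d (U i) M k) \<le> card (large_prime_set d (U i) (fst (Mk i)) k)"
        by (intro card_mono)
      then show ?thesis using Mk[OF i, of k] k \<open>snd (Mk i) \<le> k1\<close> by linarith
    qed
    obtain m where m: "\<And>j. j \<ge> 1 \<Longrightarrow> s j \<noteq> 0 \<Longrightarrow> j \<le> m"
      using fin unfolding finite_nat_set_iff_bounded_le by blast
    obtain n1 where n1: "\<And>n. n \<ge> n1 \<Longrightarrow> \<bar>c n - l\<bar> < \<epsilon> / 4"
      using LIMSEQ_D[OF l, of "\<epsilon> / 4"] \<epsilon> by auto
    define n where "n = M + m + n1 + 1"
    have n: "M < n" "\<And>j. j > n \<Longrightarrow> s j = 0" "\<bar>c n - l\<bar> < \<epsilon> / 4"
    proof -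
      show "M < n" by (simp add: n_def)
      show "s j = 0" if "j > n" for j
      proof (rule ccontr)
        assume "s j \<noteq> 0"
        then have "j \<le> m" using that by (intro m) auto
        then show False using that by (simp add: n_def)
      qed
      show "\<bar>c n - l\<bar> < \<epsilon> / 4" by (rule n1) (simp add: n_def)
    qed
    obtain k2 where k2: "\<And>k. k \<ge> k2 \<Longrightarrow> \<bar>b n k - c n\<bar> < \<epsilon> / 4"
      using LIMSEQ_D[OF dens, of "\<epsilon> / 4" n] \<epsilon> by auto
    have "norm (a k - l) < \<epsilon>" if k: "k \<ge> max k1 k2" for k
    proof -
      let ?X = "{1..d} \<rightarrow>\<^sub>E {- int k..int k}"
      let ?K = "real (2 * k + 1) ^ d"
      have "{x \<in> ?X. A n x} \<subseteq> {x \<in> ?X. gcd_vec w U x \<in> Z} \<union> (\<Union>i\<in>{1..w}. large_prime_set d (U i) M k)"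
        using in_Z[OF _ _ _ n(1,2)] by blast
      then have "card {x \<in> ?X. A n x} \<le> card ({x \<in> ?X. gcd_vec w U x \<in> Z} \<union> (\<Union>i\<in>{1..w}. large_prime_set d (U i) M k))"
        unfolding large_prime_set_def
        by (intro card_mono finite_UnI finite_UN_I) (auto intro!: finite_PiE finite_subset[OF Collect_subset])
      also have "\<dots> \<le> card {x \<in> ?X. gcd_vec w U x \<in> Z} + (\<Sum>i\<in>{1..w}. card (large_prime_set d (U i) M k))"
        by (rule order.trans[OF card_Un_le]) (intro add_left_mono card_UN_le, simp)
      finally have "real (card {x \<in> ?X. A n x}) \<le>
          real (card {x \<in> ?X. gcd_vec w U x \<in> Z}) + (\<Sum>i\<in>{1..w}. real (card (large_prime_set d (U i) M k)))"
        by (simp flip: of_nat_sum of_nat_add)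
      also have "(\<Sum>i\<in>{1..w}. real (card (large_prime_set d (U i) M k))) \<le> (\<Sum>i\<in>{1..w}. \<delta> * ?K)"
        using k by (intro sum_mono large) auto
      also have "\<dots> = \<epsilon> / 4 * ?K" using w by (simp add: \<delta>_def)
      finally have "b n k \<le> (real (card {x \<in> ?X. gcd_vec w U x \<in> Z}) + \<epsilon> / 4 * ?K) / ?K"
        unfolding b_def by (intro divide_right_mono) auto
      also have "\<dots> = a k + \<epsilon> / 4" unfolding a_def box_prob_eq by (simp add: add_divide_distrib)
      finally have "b n k \<le> a k + \<epsilon> / 4" .
      moreover have "\<bar>b n k - c n\<bar> < \<epsilon> / 4" using k by (intro k2) simp
      ultimately have "\<bar>a k - l\<bar> < \<epsilon>" using upper[of k n] n(3) by linarith
      then show ?thesis by simp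
    qed
    then show "\<exists>k0. \<forall>k\<ge>k0. norm (a k - l) < \<epsilon>" by blast
  qed
  then have "density_exists d w U Z" "gcd_density d w U Z = l"
    unfolding density_exists_def gcd_density_def a_def by (auto simp: convergent_def intro: limI)
  then show ?thesis using l unfolding c_def by simp
qed

end
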